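(* Let $R$ be a unitary ring. The following hold both with all words in parentheses omitted and with all of them included. Every non-singular (strongly) self-CS-Baer right $R$-module is (strongly) self-Baer, and every non-cosingular dual (strongly) self-CS-Baer right $R$-module is dual (strongly) self-Baer.
   Context: A submodule $L$ of $M$ lies above a direct summand $K$ of $M$ if $K\subseteq L$ and $L/K$ is superfluous in $M/K$ (a submodule $A$ of $B$ is superfluous if $A+X=B$ implies $X=B$ for every submodule $X$ of $B$). A submodule $K$ of $M$ is fully invariant if $h(K)\subseteq K$ for every endomorphism $h$ of $M$. A right $R$-module $M$ is: (strongly) self-CS-Baer if for every family $(f_i)_{i\in I}$ of endomorphisms of $M$, $\bigcap_{i\in I}\mathrm{Ker}(f_i)$ is essential in a (fully invariant) direct summand of $M$; (strongly) self-Baer if for every such family $\bigcap_{i\in I}\mathrm{Ker}(f_i)$ is a (fully invariant) direct summand of $M$; dual (strongly) self-CS-Baer if for every such family $\sum_{i\in I}\mathrm{Im}(f_i)$ lies above a (fully invariant) direct summand of $M$; dual (strongly) self-Baer if for every such family $\sum_{i\in I}\mathrm{Im}(f_i)$ is a (fully invariant) direct summand of $M$. Let $\mathcal{U}$ be the class of singular right $R$-modules, i.e. modules isomorphic to $L/K$ for some module $L$ and essential submodule $K$ of $L$, and let $\mathcal{V}$ be the class of small right $R$-modules, i.e. modules that are superfluous in some module. Set $Z(M)=\sum\{\mathrm{Im}(f)\mid f\in \mathrm{Hom}_R(U,M),\ U\in\mathcal{U}\}$ and $\overline{Z}(M)=\bigcap\{\mathrm{Ker}(f)\mid f\in\mathrm{Hom}_R(M,V),\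 V\in\mathcal{V}\}$. $M$ is non-singular if $Z(M)=0$ and non-cosingular if $\overline{Z}(M)=M$. *)

theory Defs
  imports Complex_Main "HOL-Algebra.Module" "HOL-Algebra.AbelCoset"
begin

section \<open>Right modules\<close>

text \<open>
  The library's locale \<open>module\<close> requires a commutative ring. We reuse its record type for
  right modules over an arbitrary ring with one (\<open>ring\<close> includes \<open>\<one>\<close>): \<open>a \<odot>\<^bsub>M\<^esub> x\<close> stands for
  the right action \<open>x \<cdot> a\<close>, whence the order of \<open>a\<close> and \<open>b\<close> in the associativity law.
  The ring fields \<open>mult\<close> and \<open>one\<close> of the record play no role.
\<close>

locale right_module = R?: ring R + M?: abelian_group M
  for R :: "('r, 'x) ring_scheme" (structure) and M :: "('r, 'm, 'y) module_scheme" (structure) +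
  assumes smult_closed [simp, intro]:
      "\<lbrakk>a \<in> carrier R; x \<in> carrier M\<rbrakk> \<Longrightarrow> a \<odot>\<^bsub>M\<^esub> x \<in> carrier M"
    and smult_l_distr:
      "\<lbrakk>a \<in> carrier R; b \<in> carrier R; x \<in> carrier M\<rbrakk> \<Longrightarrow>
      (a \<oplus> b) \<odot>\<^bsub>M\<^esub> x = a \<odot>\<^bsub>M\<^esub> x \<oplus>\<^bsub>M\<^esub> b \<odot>\<^bsub>M\<^esub> x"
    and smult_r_distr:
      "\<lbrakk>a \<in> carrier R; x \<in> carrier M; y \<in> carrier M\<rbrakk> \<Longrightarrow>
      a \<odot>\<^bsub>M\<^esub> (x \<oplus>\<^bsub>M\<^esub> y) = a \<odot>\<^bsub>M\<^esub> x \<oplus>\<^bsub>M\<^esub> a \<odot>\<^bsub>M\<^esub> y"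
    and smult_assoc:
      "\<lbrakk>a \<in> carrier R; b \<in> carrier R; x \<in> carrier M\<rbrakk> \<Longrightarrow>
      (a \<otimes> b) \<odot>\<^bsub>M\<^esub> x = b \<odot>\<^bsub>M\<^esub> (a \<odot>\<^bsub>M\<^esub> x)"
    and smult_one [simp]:
      "x \<in> carrier M \<Longrightarrow> \<one> \<odot>\<^bsub>M\<^esub> x = x"

text \<open>Submodules are the library's \<open>submodule\<close>, whose definition does not involve commutativity.\<close>

definition right_module_hom ::
  "('r, 'x) ring_scheme \<Rightarrow> ('r, 'm, 'y) module_scheme \<Rightarrow> ('r, 'n, 'z) module_scheme \<Rightarrow> ('m \<Rightarrow> 'n) set"
  where "right_module_hom R M N = {f \<in> carrier M \<rightarrow> carrier N.
    (\<forall>x\<in>carrier M. \<forall>y\<in>carrier M. f (x \<oplus>\<^bsub>M\<^esub> y) = f x \<oplus>\<^bsub>N\<^esub> f y) \<and>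
    (\<forall>a\<in>carrier R. \<forall>x\<in>carrier M. f (a \<odot>\<^bsub>M\<^esub> x) = a \<odot>\<^bsub>N\<^esub> f x)}"

definition module_isomorphic ::
  "('r, 'x) ring_scheme \<Rightarrow> ('r, 'm, 'y) module_scheme \<Rightarrow> ('r, 'n, 'z) module_scheme \<Rightarrow> bool"
  where "module_isomorphic R M N \<longleftrightarrow> (\<exists>f\<in>right_module_hom R M N. bij_betw f (carrier M) (carrier N))"

abbreviation sub_module :: "('r, 'm, 'y) module_scheme \<Rightarrow> 'm set \<Rightarrow> ('r, 'm, 'y) module_scheme"
  where "sub_module M N \<equiv> M\<lparr>carrier := N\<rparr>"

definition quotient_module :: "('r, 'm, 'y) module_scheme \<Rightarrow> 'm set \<Rightarrow> ('r, 'm set) module"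
  where "quotient_module M K =
    \<lparr>carrier = a_rcosets\<^bsub>M\<^esub> K, mult = undefined, one = undefined,
     zero = K, add = (\<lambda>X Y. X <+>\<^bsub>M\<^esub> Y),
     smult = (\<lambda>a X. \<Union>x\<in>X. K +>\<^bsub>M\<^esub> (a \<odot>\<^bsub>M\<^esub> x))\<rparr>"

definition superfluous ::
  "('r, 'x) ring_scheme \<Rightarrow> 'm set \<Rightarrow> ('r, 'm, 'y) module_scheme \<Rightarrow> bool"
  where "superfluous R A B \<longleftrightarrow> submodule A R B \<and>
    (\<forall>X. submodule X R B \<longrightarrow> A <+>\<^bsub>B\<^esub> X = carrier B \<longrightarrow> X = carrier B)"

definition essential ::
  "('r, 'x) ring_scheme \<Rightarrow> 'm set \<Rightarrow> ('r, 'm, 'y) module_scheme \<Rightarrow> bool"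
  where "essential R A B \<longleftrightarrow> submodule A R B \<and>
    (\<forall>X. submodule X R B \<longrightarrow> A \<inter> X = {\<zero>\<^bsub>B\<^esub>} \<longrightarrow> X = {\<zero>\<^bsub>B\<^esub>})"

definition direct_summand ::
  "('r, 'x) ring_scheme \<Rightarrow> 'm set \<Rightarrow> ('r, 'm, 'y) module_scheme \<Rightarrow> bool"
  where "direct_summand R K M \<longleftrightarrow> submodule K R M \<and>
    (\<exists>K'. submodule K' R M \<and> K <+>\<^bsub>M\<^esub> K' = carrier M \<and> K \<inter> K' = {\<zero>\<^bsub>M\<^esub>})"

definition fully_invariant ::
  "('r, 'x) ring_scheme \<Rightarrow> 'm set \<Rightarrow> ('r, 'm, 'y) module_scheme \<Rightarrow> bool"
  where "fully_invariant R K M \<longleftrightarrow> submodule K R M \<and> (\<forall>h\<in>right_module_hom R M M. h ` K \<subseteq> K)"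

definition lies_above ::
  "('r, 'x) ring_scheme \<Rightarrow> ('r, 'm, 'y) module_scheme \<Rightarrow> 'm set \<Rightarrow> 'm set \<Rightarrow> bool"
  where "lies_above R M L K \<longleftrightarrow> submodule L R M \<and> direct_summand R K M \<and> K \<subseteq> L \<and>
    superfluous R {K +>\<^bsub>M\<^esub> x |x. x \<in> L} (quotient_module M K)"

text \<open>The sum of a set of submodules: all finite sums of elements taken from them.\<close>

definition submodule_sum :: "('r, 'm, 'y) module_scheme \<Rightarrow> 'm set set \<Rightarrow> 'm set"
  where "submodule_sum M S =
    {finsum M g A |g A. finite A \<and> A \<subseteq> S \<and> (\<forall>N\<in>A. g N \<in> N)}"

section \<open>Baer-type properties\<close>

text \<open>
  The intersection and the sum below only depend on the set of members of a family of
  endomorphisms, so families are rendered as arbitrary (possibly empty) sets of endomorphisms.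
  For the empty family the intersection is \<open>M\<close> and the sum is \<open>0\<close>.
\<close>

definition common_kernel :: "('r, 'm, 'y) module_scheme \<Rightarrow> ('m \<Rightarrow> 'm) set \<Rightarrow> 'm set"
  where "common_kernel M F = {x \<in> carrier M. \<forall>f\<in>F. f x = \<zero>\<^bsub>M\<^esub>}"

definition image_sum :: "('r, 'm, 'y) module_scheme \<Rightarrow> ('m \<Rightarrow> 'm) set \<Rightarrow> 'm set"
  where "image_sum M F = submodule_sum M {f ` carrier M |f. f \<in> F}"

definition self_CS_Baer :: "('r, 'x) ring_scheme \<Rightarrow> ('r, 'm, 'y) module_scheme \<Rightarrow> bool"
  where "self_CS_Baer R M \<longleftrightarrow> (\<forall>F. F \<subseteq> right_module_hom R M M \<longrightarrow>
    (\<exists>D. direct_summand R D M \<and> essential R (common_kernel M F) (sub_module M D)))"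

definition strongly_self_CS_Baer :: "('r, 'x) ring_scheme \<Rightarrow> ('r, 'm, 'y) module_scheme \<Rightarrow> bool"
  where "strongly_self_CS_Baer R M \<longleftrightarrow> (\<forall>F. F \<subseteq> right_module_hom R M M \<longrightarrow>
    (\<exists>D. direct_summand R D M \<and> fully_invariant R D M \<and>
      essential R (common_kernel M F) (sub_module M D)))"

definition self_Baer :: "('r, 'x) ring_scheme \<Rightarrow> ('r, 'm, 'y) module_scheme \<Rightarrow> bool"
  where "self_Baer R M \<longleftrightarrow> (\<forall>F. F \<subseteq> right_module_hom R M M \<longrightarrow>
    direct_summand R (common_kernel M F) M)"

definition strongly_self_Baer :: "('r, 'x) ring_scheme \<Rightarrow> ('r, 'm, 'y) module_scheme \<Rightarrow> bool"
  where "strongly_self_Baer R M \<longleftrightarrow> (\<forall>F. F \<subseteq> right_module_hom R M M \<longrightarrow>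
    direct_summand R (common_kernel M F) M \<and> fully_invariant R (common_kernel M F) M)"

definition dual_self_CS_Baer :: "('r, 'x) ring_scheme \<Rightarrow> ('r, 'm, 'y) module_scheme \<Rightarrow> bool"
  where "dual_self_CS_Baer R M \<longleftrightarrow> (\<forall>F. F \<subseteq> right_module_hom R M M \<longrightarrow>
    (\<exists>D. lies_above R M (image_sum M F) D))"

definition dual_strongly_self_CS_Baer :: "('r, 'x) ring_scheme \<Rightarrow> ('r, 'm, 'y) module_scheme \<Rightarrow> bool"
  where "dual_strongly_self_CS_Baer R M \<longleftrightarrow> (\<forall>F. F \<subseteq> right_module_hom R M M \<longrightarrow>
    (\<exists>D. fully_invariant R D M \<and> lies_above R M (image_sum M F) D))"

definition dual_self_Baer :: "('r, 'x) ring_scheme \<Rightarrow> ('r, 'm, 'y) module_scheme \<Rightarrow> bool"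
  where "dual_self_Baer R M \<longleftrightarrow> (\<forall>F. F \<subseteq> right_module_hom R M M \<longrightarrow>
    direct_summand R (image_sum M F) M)"

definition dual_strongly_self_Baer :: "('r, 'x) ring_scheme \<Rightarrow> ('r, 'm, 'y) module_scheme \<Rightarrow> bool"
  where "dual_strongly_self_Baer R M \<longleftrightarrow> (\<forall>F. F \<subseteq> right_module_hom R M M \<longrightarrow>
    direct_summand R (image_sum M F) M \<and> fully_invariant R (image_sum M F) M)"

section \<open>Singular and small modules\<close>

text \<open>
  A HOL formula cannot quantify over all types, so the classes of singular and of small modules
  are relative to a universe, a type \<open>'u\<close> on which all the modules of the class, and the
  modules witnessing membership, live. \<open>Z_sub\<close> is the trace of the singular modules (usually
  written $Z(M)$), \<open>Z_bar\<close> its dual defined by the small modules. For a module on \<open>'m\<close> over a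
  ring on \<open>'r\<close> the universe is then fixed to the type \<open>('r, 'm) universe\<close>. It is large enough:
  the theorems \<open>Z_sub_universe\<close> and \<open>Z_bar_universe\<close> at the end show that modules on any
  other type neither enlarge \<open>Z_sub\<close> nor shrink \<open>Z_bar\<close>.
\<close>

definition singular_module ::
  "'u itself \<Rightarrow> ('r, 'x) ring_scheme \<Rightarrow> ('r, 'n, 'y) module_scheme \<Rightarrow> bool"
  where "singular_module (_ :: 'u itself) R U \<longleftrightarrow> right_module R U \<and>
    (\<exists>(L :: ('r, 'u) module) K. right_module R L \<and> essential R K L \<and>
      module_isomorphic R U (quotient_module L K))"

text \<open>As usual, ``superfluous in some module'' is understood up to isomorphism.\<close>

definition small_module ::
  "'u itself \<Rightarrow> ('r, 'x) ring_scheme \<Rightarrow> ('r, 'n, 'y) module_scheme \<Rightarrow> bool"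
  where "small_module (_ :: 'u itself) R V \<longleftrightarrow> right_module R V \<and>
    (\<exists>(W :: ('r, 'u) module) N. right_module R W \<and> superfluous R N W \<and>
      module_isomorphic R V (sub_module W N))"

definition Z_sub :: "'u itself \<Rightarrow> ('r, 'x) ring_scheme \<Rightarrow> ('r, 'm, 'y) module_scheme \<Rightarrow> 'm set"
  where "Z_sub (u :: 'u itself) R M =
    submodule_sum M {f ` carrier U |f (U :: ('r, 'u) module).
      singular_module u R U \<and> f \<in> right_module_hom R U M}"

definition Z_bar :: "'u itself \<Rightarrow> ('r, 'x) ring_scheme \<Rightarrow> ('r, 'm, 'y) module_scheme \<Rightarrow> 'm set"
  where "Z_bar (u :: 'u itself) R M =
    {x \<in> carrier M. \<forall>(V :: ('r, 'u) module) f.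
      small_module u R V \<longrightarrow> f \<in> right_module_hom R M V \<longrightarrow> f x = \<zero>\<^bsub>V\<^esub>}"

type_synonym ('r, 'm) universe = "'m \<Rightarrow> 'r \<Rightarrow> complex"

definition non_singular :: "('r, 'x) ring_scheme \<Rightarrow> ('r, 'm, 'y) module_scheme \<Rightarrow> bool"
  where "non_singular R M \<longleftrightarrow> Z_sub TYPE(('r, 'm) universe) R M = {\<zero>\<^bsub>M\<^esub>}"

definition non_cosingular :: "('r, 'x) ring_scheme \<Rightarrow> ('r, 'm, 'y) module_scheme \<Rightarrow> bool"
  where "non_cosingular R M \<longleftrightarrow> Z_bar TYPE(('r, 'm) universe) R M = carrier M"

section \<open>The universe is large enough\<close>

subsection \<open>Characters separate the points of an abelian group\<close>

text \<open>Graphs of characters, with values in the unit circle, of subgroups of \<open>G\<close>.\<close>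

definition partial_character :: "('a, 'b) monoid_scheme \<Rightarrow> ('a \<times> complex) set \<Rightarrow> bool"
  where "partial_character G P \<longleftrightarrow> P \<subseteq> carrier G \<times> {c. cmod c = 1} \<and> (\<one>\<^bsub>G\<^esub>, 1) \<in> P \<and>
    (\<forall>x a y b. (x, a) \<in> P \<longrightarrow> (y, b) \<in> P \<longrightarrow> (x \<otimes>\<^bsub>G\<^esub> y, a * b) \<in> P) \<and>
    (\<forall>x a. (x, a) \<in> P \<longrightarrow> (inv\<^bsub>G\<^esub> x, inverse a) \<in> P) \<and>
    (\<forall>a. (\<one>\<^bsub>G\<^esub>, a) \<in> P \<longrightarrow> a = 1)"

lemma partial_character_unique:
  assumes "group G" "partial_character G P" "(x, a) \<in> P" "(x, b) \<in> P"
  shows "a = b"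
proof -
  interpret group G by fact
  have x: "x \<in> carrier G" and b: "cmod b = 1"
    using assms unfolding partial_character_def by auto
  have "(x \<otimes>\<^bsub>G\<^esub> inv\<^bsub>G\<^esub> x, a * inverse b) \<in> P"
    using assms unfolding partial_character_def by blast
  hence "a * inverse b = 1"
    using assms(2) x unfolding partial_character_def by auto
  thus ?thesis using b by (metis divide_inverse norm_zero right_inverse_eq zero_neq_one)
qed

lemma cis_of_unit: "cmod a = 1 \<Longrightarrow> \<exists>s. a = cis s"
  by (metis cis_Arg div_by_1 norm_zero of_real_1 sgn_eq zero_neq_one)

lemma partial_character_int_pow:
  assumes "group G" "partial_character G P" "(x, cis s) \<in> P"
  shows "(x [^]\<^bsub>G\<^esub> (k::int), cis (real_of_int k * s)) \<in> P"
proof -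
  interpret group G by fact
  have x: "x \<in> carrier G" using assms unfolding partial_character_def by auto
  have nat: "(x [^]\<^bsub>G\<^esub> int n, cis (real n * s)) \<in> P" for n
  proof (induction n)
    case 0 thus ?case using assms unfolding partial_character_def by auto
  next
    case (Suc n)
    have "(x [^]\<^bsub>G\<^esub> int n \<otimes>\<^bsub>G\<^esub> x, cis (real n * s) * cis s) \<in> P"
      using Suc assms unfolding partial_character_def by blast
    moreover have "x [^]\<^bsub>G\<^esub> int (Suc n) = x [^]\<^bsub>G\<^esub> int n \<otimes>\<^bsub>G\<^esub> x"
      using int_pow_mult[OF x, of "int n" 1] x by (simp add: add.commute)
    ultimately show ?case by (simp add: cis_mult algebra_simps)
  qed
  show ?thesis
  proof (cases k rule: int_cases2)
    case (nonneg n) thus ?thesis using nat[of n] by simp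
  next
    case (nonpos n)
    have "(inv\<^bsub>G\<^esub> (x [^]\<^bsub>G\<^esub> int n), inverse (cis (real n * s))) \<in> P"
      using nat[of n] assms unfolding partial_character_def by blast
    thus ?thesis using nonpos x by (simp add: int_pow_neg)
  qed
qed

lemma partial_character_extend:
  assumes "comm_group G" and P: "partial_character G P" and w: "w \<in> carrier G" "w \<notin> Domain P"
  shows "\<exists>Q c. partial_character G Q \<and> P \<subseteq> Q \<and> (w, c) \<in> Q \<and> c \<noteq> 1"
proof -
  interpret comm_group G by fact
  note pc = P[unfolded partial_character_def]
  define I where "I = {k::int. w [^]\<^bsub>G\<^esub> k \<in> Domain P}"
  have one: "(\<one>\<^bsub>G\<^esub>, 1) \<in> P" using pc by blast
  have I0: "0 \<in> I" using one unfolding I_def by auto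
  have Idiff: "i - j * q \<in> I" if "i \<in> I" "j \<in> I" for i j q
  proof -
    obtain a b where ab: "(w [^]\<^bsub>G\<^esub> i, a) \<in> P" "(w [^]\<^bsub>G\<^esub> j, b) \<in> P"
      using \<open>i \<in> I\<close> \<open>j \<in> I\<close> unfolding I_def by auto
    obtain s where "b = cis s" using ab pc cis_of_unit by blast
    hence "((w [^]\<^bsub>G\<^esub> j) [^]\<^bsub>G\<^esub> (-q), cis (real_of_int (-q) * s)) \<in> P"
      using partial_character_int_pow[OF is_group P] ab by blast
    hence "(w [^]\<^bsub>G\<^esub> i \<otimes>\<^bsub>G\<^esub> (w [^]\<^bsub>G\<^esub> j) [^]\<^bsub>G\<^esub> (-q), a * cis (real_of_int (-q) * s)) \<in> P"
      using ab pc by blast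
    moreover have "w [^]\<^bsub>G\<^esub> i \<otimes>\<^bsub>G\<^esub> (w [^]\<^bsub>G\<^esub> j) [^]\<^bsub>G\<^esub> (-q) = w [^]\<^bsub>G\<^esub> (i - j * q)"
      using w by (simp add: int_pow_pow int_pow_mult[symmetric])
    ultimately show ?thesis unfolding I_def by auto
  qed
  have "\<exists>t. cis t \<noteq> 1 \<and> (\<forall>k a. (w [^]\<^bsub>G\<^esub> k, a) \<in> P \<longrightarrow> a = cis (real_of_int k * t))"
  proof (cases "\<exists>n\<in>I. n > 0")
    case False
    have "k = 0" if "k \<in> I" for k
    proof (rule ccontr)
      assume "k \<noteq> 0"
      moreover have "- k \<in> I" using Idiff[OF I0 that, of 1] by simp
      ultimately show False using False that by (meson neg_0_less_iff_less linorder_neqE)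
    qed
    hence "a = cis (real_of_int k * pi)" if "(w [^]\<^bsub>G\<^esub> k, a) \<in> P" for k a
    proof -
      have "k = 0" using that \<open>\<And>k. k \<in> I \<Longrightarrow> k = 0\<close> unfolding I_def by blast
      moreover have "\<forall>a. (\<one>\<^bsub>G\<^esub>, a) \<in> P \<longrightarrow> a = 1" using pc by blast
      ultimately show ?thesis using that by auto
    qed
    moreover have "cis pi \<noteq> 1" by simp
    ultimately show ?thesis by blast
  next
    case True
    then obtain m where m: "m \<in> I" "m > 0" by blast
    define n where "n = (LEAST n::nat. int n \<in> I \<and> n > 0)"
    have "int (nat m) \<in> I \<and> nat m > 0" using m by simp
    hence "int n \<in> I \<and> n > 0" unfolding n_def by (rule LeastI)
    hence n: "int n \<in> I" "n > 0" by auto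
    have nmin: "n \<le> k" if "int k \<in> I" "k > 0" for k
      unfolding n_def by (rule Least_le) (use that in simp)
    have dvd: "int n dvd k" if "k \<in> I" for k
    proof -
      have "k mod int n \<in> I"
        using Idiff[OF that n(1), of "k div int n"] by (simp add: minus_mult_div_eq_mod)
      moreover have "0 \<le> k mod int n" "k mod int n < int n" using n by auto
      ultimately have "k mod int n = 0"
        using nmin[of "nat (k mod int n)"] by (cases "k mod int n = 0") auto
      thus ?thesis by auto
    qed
    have n1: "n \<noteq> 1" using n w unfolding I_def by auto
    obtain a where a: "(w [^]\<^bsub>G\<^esub> int n, a) \<in> P" using n unfolding I_def by auto
    obtain s where s: "a = cis s" using a pc cis_of_unit by blast
    have "\<exists>t. cis t \<noteq> 1 \<and> cis (real n * t) = a"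
    proof (cases "cis (s / n) = 1")
      case False thus ?thesis using s n by (intro exI[of _ "s / n"]) auto
    next
      case True
      have "cis (2 * pi / n) \<noteq> 1"
      proof
        assume "cis (2 * pi / n) = 1"
        hence "cos (2 * pi / n) = 1" by (metis cis.simps(1) one_complex.simps(1))
        then obtain x :: int where "2 * pi / n = of_int x * 2 * pi"
          by (meson cos_one_2pi_int)
        hence "of_int x * real n = 1" using n by (simp add: field_simps)
        hence "x * int n = 1" by (metis of_int_eq_1_iff of_int_mult of_int_of_nat_eq)
        thus False using n1 n by (metis dvd_triv_right int_dvd_int_iff nat_dvd_1_iff_1 of_nat_1)
      qed
      hence "cis ((s + 2 * pi) / n) \<noteq> 1"
        using True by (simp add: add_divide_distrib flip: cis_mult)
      moreover have "cis (real n * ((s + 2 * pi) / n)) = a"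
        using n s by (simp flip: cis_mult)
      ultimately show ?thesis by blast
    qed
    then obtain t where t: "cis t \<noteq> 1" "cis (real n * t) = a" by blast
    have "b = cis (real_of_int k * t)" if b: "(w [^]\<^bsub>G\<^esub> k, b) \<in> P" for k b
    proof -
      obtain q where q: "k = int n * q" using dvd[of k] b unfolding I_def by auto
      have "((w [^]\<^bsub>G\<^esub> int n) [^]\<^bsub>G\<^esub> q, cis (real_of_int q * (real n * t))) \<in> P"
        by (rule partial_character_int_pow[OF is_group P]) (use a t in simp)
      hence "(w [^]\<^bsub>G\<^esub> k, cis (real_of_int k * t)) \<in> P"
        using w q by (simp add: int_pow_pow mult_ac)
      thus ?thesis using partial_character_unique[OF is_group P b] by blast
    qed
    thus ?thesis using t by blast
  qed
  then obtain t where t: "cis t \<noteq> 1"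
    and tP: "\<And>k a. (w [^]\<^bsub>G\<^esub> k, a) \<in> P \<Longrightarrow> a = cis (real_of_int k * t)" by blast
  define Q where "Q = {(w [^]\<^bsub>G\<^esub> k \<otimes>\<^bsub>G\<^esub> x, cis (real_of_int k * t) * a) |k x a. (x, a) \<in> P}"
  have QI: "(z, c) \<in> Q" if "(x, a) \<in> P" "z = w [^]\<^bsub>G\<^esub> k \<otimes>\<^bsub>G\<^esub> x"
    "c = cis (real_of_int k * t) * a" for z c k x a
    unfolding Q_def using that by auto
  have PG: "x \<in> carrier G" "cmod a = 1" if "(x, a) \<in> P" for x a using that pc by auto
  have "P \<subseteq> Q"
  proof (rule subrelI)
    fix x a assume "(x, a) \<in> P"
    moreover have "x = w [^]\<^bsub>G\<^esub> (0::int) \<otimes>\<^bsub>G\<^esub> x" using PG calculation by simp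
    ultimately show "(x, a) \<in> Q" unfolding Q_def
      by (auto intro!: exI[of _ "0::int"] exI[of _ x] exI[of _ a])
  qed
  moreover have "(w, cis t) \<in> Q"
    unfolding Q_def using one w by (auto intro!: exI[of _ "1::int"] exI[of _ "\<one>\<^bsub>G\<^esub>"] exI[of _ "1"])
  moreover have "partial_character G Q"
    unfolding partial_character_def
  proof (intro conjI allI impI)
    show "Q \<subseteq> carrier G \<times> {c. cmod c = 1}"
      unfolding Q_def using w PG by (auto simp: norm_mult)
    show "(\<one>\<^bsub>G\<^esub>, 1) \<in> Q" using \<open>P \<subseteq> Q\<close> one by blast
  next
    fix x a y b assume "(x, a) \<in> Q" "(y, b) \<in> Q"
    then obtain k x' a' l y' b' where e: "(x', a') \<in> P" "(y', b') \<in> P"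
      "x = w [^]\<^bsub>G\<^esub> k \<otimes>\<^bsub>G\<^esub> x'" "a = cis (real_of_int k * t) * a'"
      "y = w [^]\<^bsub>G\<^esub> l \<otimes>\<^bsub>G\<^esub> y'" "b = cis (real_of_int l * t) * b'"
      unfolding Q_def by auto
    have "(x' \<otimes>\<^bsub>G\<^esub> y', a' * b') \<in> P" using e pc by blast
    moreover have "x \<otimes>\<^bsub>G\<^esub> y = w [^]\<^bsub>G\<^esub> (k + l) \<otimes>\<^bsub>G\<^esub> (x' \<otimes>\<^bsub>G\<^esub> y')"
      using e PG w by (simp add: int_pow_mult m_ac)
    moreover have "a * b = cis (real_of_int (k + l) * t) * (a' * b')"
    proof -
      have "cis (real_of_int (k + l) * t) = cis (real_of_int k * t) * cis (real_of_int l * t)"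
        by (simp add: cis_mult distrib_right)
      thus ?thesis using e by (simp only: mult_ac)
    qed
    ultimately show "(x \<otimes>\<^bsub>G\<^esub> y, a * b) \<in> Q" by (rule QI)
  next
    fix x a assume "(x, a) \<in> Q"
    then obtain k x' a' where e: "(x', a') \<in> P"
      "x = w [^]\<^bsub>G\<^esub> k \<otimes>\<^bsub>G\<^esub> x'" "a = cis (real_of_int k * t) * a'"
      unfolding Q_def by auto
    have "(inv\<^bsub>G\<^esub> x', inverse a') \<in> P" using e pc by blast
    moreover have "inv\<^bsub>G\<^esub> x = w [^]\<^bsub>G\<^esub> (- k) \<otimes>\<^bsub>G\<^esub> inv\<^bsub>G\<^esub> x'"
      using e PG w by (simp add: int_pow_neg inv_mult)
    moreover have "inverse a = cis (real_of_int (- k) * t) * inverse a'"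
      using e by (simp add: inverse_mult_distrib)
    ultimately show "(inv\<^bsub>G\<^esub> x, inverse a) \<in> Q" by (rule QI)
  next
    fix a assume "(\<one>\<^bsub>G\<^esub>, a) \<in> Q"
    then obtain k x' a' where e: "(x', a') \<in> P"
      "\<one>\<^bsub>G\<^esub> = w [^]\<^bsub>G\<^esub> k \<otimes>\<^bsub>G\<^esub> x'" "a = cis (real_of_int k * t) * a'"
      unfolding Q_def by auto
    have "w [^]\<^bsub>G\<^esub> k = inv\<^bsub>G\<^esub> x'"
      using inv_equality[OF e(2)[symmetric]] PG(1)[OF e(1)] w(1) by simp
    moreover have "(inv\<^bsub>G\<^esub> x', inverse a') \<in> P" using e pc by blast
    ultimately have "(w [^]\<^bsub>G\<^esub> k, inverse a') \<in> P" by simp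
    hence "inverse a' = cis (real_of_int k * t)" by (rule tP)
    moreover have "a' \<noteq> 0" using PG(2)[OF e(1)] by auto
    ultimately show "a = 1" using e(3) by (simp add: field_simps)
  qed
  ultimately show ?thesis using t by blast
qed

lemma separating_character:
  assumes "comm_group G" and y: "y \<in> carrier G" "y \<noteq> \<one>\<^bsub>G\<^esub>"
  shows "\<exists>\<psi> :: 'a \<Rightarrow> complex. \<psi> y \<noteq> 1 \<and> \<psi> \<one>\<^bsub>G\<^esub> = 1 \<and>
    (\<forall>a\<in>carrier G. \<forall>b\<in>carrier G. \<psi> (a \<otimes>\<^bsub>G\<^esub> b) = \<psi> a * \<psi> b)"
proof -
  interpret comm_group G by fact
  have "partial_character G {(\<one>\<^bsub>G\<^esub>, 1)}" unfolding partial_character_def by auto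
  then obtain P0 c where P0: "partial_character G P0" "(y, c) \<in> P0" "c \<noteq> 1"
    using partial_character_extend[OF assms(1), of "{(\<one>\<^bsub>G\<^esub>, 1)}" y] y by auto
  define A where "A = {P. partial_character G P \<and> P0 \<subseteq> P}"
  have "\<exists>P\<in>A. \<forall>X\<in>A. P \<subseteq> X \<longrightarrow> X = P"
  proof (rule subset_Zorn_nonempty)
    show "A \<noteq> {}" using P0 unfolding A_def by blast
    fix C assume C: "C \<noteq> {}" "subset.chain A C"
    have mem: "partial_character G P" "P0 \<subseteq> P" if "P \<in> C" for P
      using C that unfolding subset.chain_def A_def by auto
    have lin: "P \<subseteq> Q \<or> Q \<subseteq> P" if "P \<in> C" "Q \<in> C" for P Q
      using C that unfolding subset.chain_def by blast
    have "partial_character G (\<Union>C)"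
      unfolding partial_character_def
    proof (intro conjI allI impI)
      show "\<Union>C \<subseteq> carrier G \<times> {c. cmod c = 1}"
        using mem(1) unfolding partial_character_def by blast
      show "(\<one>\<^bsub>G\<^esub>, 1) \<in> \<Union>C"
        using mem(1) C(1) unfolding partial_character_def by blast
    next
      fix x a y b assume "(x, a) \<in> \<Union>C" "(y, b) \<in> \<Union>C"
      then obtain P where "P \<in> C" "(x, a) \<in> P" "(y, b) \<in> P" using lin by blast
      thus "(x \<otimes>\<^bsub>G\<^esub> y, a * b) \<in> \<Union>C"
        using mem(1)[of P] unfolding partial_character_def by blast
    next
      fix x a assume "(x, a) \<in> \<Union>C"
      thus "(inv\<^bsub>G\<^esub> x, inverse a) \<in> \<Union>C"
        using mem(1) unfolding partial_character_def by blast
    next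
      fix a assume "(\<one>\<^bsub>G\<^esub>, a) \<in> \<Union>C"
      thus "a = 1" using mem(1) unfolding partial_character_def by blast
    qed
    moreover have "P0 \<subseteq> \<Union>C" using mem C by blast
    ultimately show "\<Union>C \<in> A" unfolding A_def by blast
  qed
  then obtain P where P: "partial_character G P" "P0 \<subseteq> P"
    and max: "\<And>X. partial_character G X \<Longrightarrow> P \<subseteq> X \<Longrightarrow> X = P"
    unfolding A_def by (smt (verit) mem_Collect_eq subset_trans)
  have dom: "w \<in> Domain P" if "w \<in> carrier G" for w
    using partial_character_extend[OF assms(1) P(1) that] max by blast
  define \<psi> where "\<psi> w = (THE a. (w, a) \<in> P)" for w
  have psi: "\<psi> w = a" if "(w, a) \<in> P" for w a
    unfolding \<psi>_def using that partial_character_unique[OF is_group P(1)] by blast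
  have "\<psi> y \<noteq> 1" using psi P0 P by blast
  moreover have "\<psi> \<one>\<^bsub>G\<^esub> = 1" using psi P(1) unfolding partial_character_def by blast
  moreover have "\<psi> (a \<otimes>\<^bsub>G\<^esub> b) = \<psi> a * \<psi> b" if a: "a \<in> carrier G" and b: "b \<in> carrier G" for a b
  proof -
    obtain u where u: "(a, u) \<in> P" using dom[OF a] by blast
    obtain v where v: "(b, v) \<in> P" using dom[OF b] by blast
    have "(a \<otimes>\<^bsub>G\<^esub> b, u * v) \<in> P"
      using P(1) u v unfolding partial_character_def by blast
    thus ?thesis using psi u v by simp
  qed
  ultimately show ?thesis by blast
qed

subsection \<open>Images and preimages of submodules\<close>

lemma submodule_iff:
  assumes "right_module R M"
  shows "submodule H R M \<longleftrightarrow> H \<subseteq> carrier M \<and> \<zero>\<^bsub>M\<^esub> \<in> H \<and>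
    (\<forall>a\<in>H. \<ominus>\<^bsub>M\<^esub> a \<in> H) \<and> (\<forall>a\<in>H. \<forall>b\<in>H. a \<oplus>\<^bsub>M\<^esub> b \<in> H) \<and>
    (\<forall>a\<in>carrier R. \<forall>x\<in>H. a \<odot>\<^bsub>M\<^esub> x \<in> H)"
  unfolding submodule_def submodule_axioms_def subgroup_def a_inv_def by auto

lemma right_module_image:
  assumes M: "right_module R M"
    and add: "\<And>x y. x \<in> carrier M \<Longrightarrow> y \<in> carrier M \<Longrightarrow> f (x \<oplus>\<^bsub>M\<^esub> y) = f x \<oplus>\<^bsub>N\<^esub> f y"
    and smult: "\<And>a x. a \<in> carrier R \<Longrightarrow> x \<in> carrier M \<Longrightarrow> f (a \<odot>\<^bsub>M\<^esub> x) = a \<odot>\<^bsub>N\<^esub> f x"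
    and zero: "f \<zero>\<^bsub>M\<^esub> = \<zero>\<^bsub>N\<^esub>"
  shows "right_module R (N\<lparr>carrier := f ` carrier M\<rparr>)"
proof -
  interpret M: right_module R M by fact
  show ?thesis
  proof (intro right_module.intro right_module_axioms.intro abelian_groupI)
    show "ring R" by (rule M.R.ring_axioms)
    show "\<exists>y\<in>carrier (N\<lparr>carrier := f ` carrier M\<rparr>).
      y \<oplus>\<^bsub>N\<lparr>carrier := f ` carrier M\<rparr>\<^esub> x = \<zero>\<^bsub>N\<lparr>carrier := f ` carrier M\<rparr>\<^esub>"
      if "x \<in> carrier (N\<lparr>carrier := f ` carrier M\<rparr>)" for x
    proof -
      obtain z where z: "z \<in> carrier M" "x = f z" using \<open>x \<in> _\<close> by auto
      hence "f (\<ominus>\<^bsub>M\<^esub> z) \<oplus>\<^bsub>N\<^esub> f z = \<zero>\<^bsub>N\<^esub>"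
        by (simp add: add[symmetric] zero[symmetric] M.l_neg)
      thus ?thesis using z by auto
    qed
  qed (auto simp: add[symmetric] smult[symmetric] zero[symmetric] M.a_assoc M.smult_l_distr
      M.smult_r_distr M.smult_assoc M.a_ac)
qed

lemma right_module_sub_module:
  assumes M: "right_module R M" and "submodule H R M"
  shows "right_module R (sub_module M H)"
proof -
  interpret M: right_module R M by fact
  note H = assms(2)[unfolded submodule_iff[OF M]]
  have HM: "x \<in> carrier M" if "x \<in> H" for x using H that by blast
  show ?thesis
  proof (intro right_module.intro right_module_axioms.intro abelian_groupI)
    show "ring R" by (rule M.R.ring_axioms)
    show "\<exists>y\<in>carrier (sub_module M H). y \<oplus>\<^bsub>sub_module M H\<^esub> x = \<zero>\<^bsub>sub_module M H\<^esub>"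
      if "x \<in> carrier (sub_module M H)" for x
      using that H HM by (auto intro!: bexI[of _ "\<ominus>\<^bsub>M\<^esub> x"] simp: M.l_neg)
  qed (use H HM in \<open>auto simp: M.a_assoc M.smult_l_distr
      M.smult_r_distr M.smult_assoc intro: M.a_comm\<close>)
qed

lemma right_module_hom_zero:
  assumes "right_module R M" "right_module R N" "f \<in> right_module_hom R M N"
  shows "f \<zero>\<^bsub>M\<^esub> = \<zero>\<^bsub>N\<^esub>"
proof -
  interpret M: right_module R M by fact
  interpret N: right_module R N by fact
  have "f (\<zero>\<^bsub>M\<^esub> \<oplus>\<^bsub>M\<^esub> \<zero>\<^bsub>M\<^esub>) = f \<zero>\<^bsub>M\<^esub> \<oplus>\<^bsub>N\<^esub> f \<zero>\<^bsub>M\<^esub>" and "f \<zero>\<^bsub>M\<^esub> \<in> carrier N"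
    using assms(3) unfolding right_module_hom_def by blast+
  thus ?thesis by (metis M.l_zero M.zero_closed N.add.l_cancel_one')
qed

lemma right_module_hom_minus:
  assumes "right_module R M" "right_module R N" "f \<in> right_module_hom R M N" "x \<in> carrier M"
  shows "f (\<ominus>\<^bsub>M\<^esub> x) = \<ominus>\<^bsub>N\<^esub> f x"
proof -
  interpret M: right_module R M by fact
  interpret N: right_module R N by fact
  have "f (\<ominus>\<^bsub>M\<^esub> x \<oplus>\<^bsub>M\<^esub> x) = f (\<ominus>\<^bsub>M\<^esub> x) \<oplus>\<^bsub>N\<^esub> f x"
    and *: "f (\<ominus>\<^bsub>M\<^esub> x) \<in> carrier N" "f x \<in> carrier N"
    using assms(3,4) unfolding right_module_hom_def by (blast intro: M.a_inv_closed)+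
  hence "f (\<ominus>\<^bsub>M\<^esub> x) \<oplus>\<^bsub>N\<^esub> f x = \<zero>\<^bsub>N\<^esub>"
    using right_module_hom_zero[OF assms(1-3)] assms(4) by (simp add: M.l_neg)
  thus ?thesis using * by (metis N.minus_equality)
qed

lemma submodule_vimage:
  assumes M: "right_module R M" and N: "right_module R N" and f: "f \<in> right_module_hom R M N"
    and H: "submodule H R N"
  shows "submodule {x \<in> carrier M. f x \<in> H} R M"
proof -
  interpret M: right_module R M by fact
  interpret N: right_module R N by fact
  show ?thesis
    using H f right_module_hom_zero[OF M N f] right_module_hom_minus[OF M N f]
    unfolding submodule_iff[OF M] submodule_iff[OF N] right_module_hom_def by auto
qed

lemma submodule_image:
  assumes M: "right_module R M" and N: "right_module R N" and f: "f \<in> right_module_hom R M N"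
    and H: "submodule H R M"
  shows "submodule (f ` H) R N"
proof -
  have H': "H \<subseteq> carrier M" using H unfolding submodule_iff[OF M] by blast
  hence f': "f (x \<oplus>\<^bsub>M\<^esub> y) = f x \<oplus>\<^bsub>N\<^esub> f y" "f (\<ominus>\<^bsub>M\<^esub> x) = \<ominus>\<^bsub>N\<^esub> f x" if "x \<in> H" "y \<in> H" for x y
    using f that right_module_hom_minus[OF M N f] unfolding right_module_hom_def by blast+
  have f'': "f (a \<odot>\<^bsub>M\<^esub> x) = a \<odot>\<^bsub>N\<^esub> f x" if "x \<in> H" "a \<in> carrier R" for x a
    using f that H' unfolding right_module_hom_def by blast+
  have f3: "f x \<in> carrier N" if "x \<in> H" for x
    using f that H' unfolding right_module_hom_def by blast
  show ?thesis
    using H unfolding submodule_iff[OF M] submodule_iff[OF N]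
    by (auto simp: f'[symmetric] f''[symmetric] right_module_hom_zero[OF M N f, symmetric] f3)
qed

lemma superfluous_image:
  assumes W: "right_module R W" and W': "right_module R W'"
    and f: "f \<in> right_module_hom R W W'" and onto: "carrier W' = f ` carrier W"
    and sup: "superfluous R N W"
  shows "superfluous R (f ` N) W'"
  unfolding superfluous_def
proof (intro conjI allI impI)
  interpret W: right_module R W by fact
  interpret W': right_module R W' by fact
  have N: "submodule N R W" using sup unfolding superfluous_def by blast
  show "submodule (f ` N) R W'" by (rule submodule_image[OF W W' f N])
  fix X assume X: "submodule X R W'" and eq: "f ` N <+>\<^bsub>W'\<^esub> X = carrier W'"
  define Y where "Y = {x \<in> carrier W. f x \<in> X}"
  have Y: "submodule Y R W" unfolding Y_def by (rule submodule_vimage[OF W W' f X])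
  have NW: "N \<subseteq> carrier W" and YW: "Y \<subseteq> carrier W" and XW: "X \<subseteq> carrier W'"
    using N Y X unfolding submodule_iff[OF W] submodule_iff[OF W'] by blast+
  have "N <+>\<^bsub>W\<^esub> Y = carrier W"
  proof
    show "N <+>\<^bsub>W\<^esub> Y \<subseteq> carrier W" using NW YW by (auto simp: set_add_def')
    show "carrier W \<subseteq> N <+>\<^bsub>W\<^esub> Y"
    proof
      fix w assume w: "w \<in> carrier W"
      hence "f w \<in> f ` N <+>\<^bsub>W'\<^esub> X" using eq onto by blast
      then obtain n x where n: "n \<in> N" and x: "x \<in> X" and fw: "f w = f n \<oplus>\<^bsub>W'\<^esub> x"
        by (auto simp: set_add_def')
      have nW: "n \<in> carrier W" using n NW by blast
      have fn: "f n \<in> carrier W'" and xW: "x \<in> carrier W'" using nW onto x XW by blast+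
      have "f (\<ominus>\<^bsub>W\<^esub> n \<oplus>\<^bsub>W\<^esub> w) = f (\<ominus>\<^bsub>W\<^esub> n) \<oplus>\<^bsub>W'\<^esub> f w"
        using f w nW unfolding right_module_hom_def by simp
      also have "\<dots> = \<ominus>\<^bsub>W'\<^esub> f n \<oplus>\<^bsub>W'\<^esub> (f n \<oplus>\<^bsub>W'\<^esub> x)"
        using right_module_hom_minus[OF W W' f nW] fw by simp
      also have "\<dots> = x" using fn xW by (simp add: W'.r_neg1)
      finally have "\<ominus>\<^bsub>W\<^esub> n \<oplus>\<^bsub>W\<^esub> w \<in> Y" using w nW x unfolding Y_def by simp
      moreover have "w = n \<oplus>\<^bsub>W\<^esub> (\<ominus>\<^bsub>W\<^esub> n \<oplus>\<^bsub>W\<^esub> w)" using w nW by (simp add: W.r_neg2)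
      ultimately show "w \<in> N <+>\<^bsub>W\<^esub> Y" using n by (auto simp: set_add_def')
    qed
  qed
  hence "Y = carrier W" using sup Y unfolding superfluous_def by blast
  hence "f w \<in> X" if "w \<in> carrier W" for w using that unfolding Y_def by auto
  hence "carrier W' \<subseteq> X" unfolding onto by auto
  thus "X = carrier W'" using XW by auto
qed

subsection \<open>Small modules on an arbitrary type\<close>

text \<open>
  Given \<open>f : M \<rightarrow> V\<close> with \<open>V\<close> superfluous in \<open>W\<close> and \<open>f x \<noteq> 0\<close>, a character \<open>\<psi>\<close> of \<open>W\<close> with
  \<open>\<psi> (f x) \<noteq> 1\<close> yields the homomorphism sending \<open>w\<close> to the function \<open>r \<mapsto> \<psi> (w \<cdot> r)\<close>; its image lives
  in the universe, and superfluous submodules are preserved by surjections.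
\<close>

theorem Z_bar_universe:
  fixes R :: "('r, 'x) ring_scheme" and M :: "('r, 'm, 'y) module_scheme"
  assumes M: "right_module R M"
  shows "Z_bar TYPE(('r, 'm) universe) R M \<subseteq> Z_bar TYPE('w) R M"
proof
  interpret M: right_module R M by fact
  fix x assume x: "x \<in> Z_bar TYPE(('r, 'm) universe) R M"
  hence xM: "x \<in> carrier M" unfolding Z_bar_def by blast
  have "f x = \<zero>\<^bsub>V\<^esub>" if small: "small_module TYPE('w) R V" and f: "f \<in> right_module_hom R M V"
    for f and V :: "('r, 'w) module"
  proof (rule ccontr)
    assume fx: "f x \<noteq> \<zero>\<^bsub>V\<^esub>"
    from small obtain W :: "('r, 'w) module" and N h
      where V: "right_module R V" and W: "right_module R W" and sup: "superfluous R N W"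
        and h: "h \<in> right_module_hom R V (sub_module W N)" and bij: "bij_betw h (carrier V) N"
      unfolding small_module_def module_isomorphic_def by auto
    interpret V: right_module R V by fact
    interpret W: right_module R W by fact
    have N: "submodule N R W" using sup unfolding superfluous_def by blast
    have NW: "N \<subseteq> carrier W" using N unfolding submodule_iff[OF W] by blast
    define g where "g = (\<lambda>m. h (f m))"
    have gN: "g m \<in> N" if "m \<in> carrier M" for m
      using that f h unfolding g_def right_module_hom_def by auto
    have gW: "g m \<in> carrier W" if "m \<in> carrier M" for m using gN NW that by blast
    have fV: "f m \<in> carrier V" if "m \<in> carrier M" for m
      using that f unfolding right_module_hom_def by auto
    have g_add: "g (m \<oplus>\<^bsub>M\<^esub> n) = g m \<oplus>\<^bsub>W\<^esub> g n" if "m \<in> carrier M" "n \<in> carrier M" for m n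
      using that f h fV unfolding g_def right_module_hom_def by auto
    have g_smult: "g (a \<odot>\<^bsub>M\<^esub> m) = a \<odot>\<^bsub>W\<^esub> g m" if "a \<in> carrier R" "m \<in> carrier M" for a m
      using that f h fV unfolding g_def right_module_hom_def by auto
    have "h \<zero>\<^bsub>V\<^esub> = \<zero>\<^bsub>W\<^esub>"
      using right_module_hom_zero[OF V right_module_sub_module[OF W N] h] by simp
    hence gx: "g x \<noteq> \<zero>\<^bsub>W\<^esub>"
      using bij fx fV[OF xM] unfolding g_def bij_betw_def inj_on_def by (metis V.zero_closed)
    obtain \<psi> :: "'w \<Rightarrow> complex" where psi: "\<psi> (g x) \<noteq> 1" and psi0: "\<psi> \<zero>\<^bsub>W\<^esub> = 1"
      and psi_add: "\<And>v w. v \<in> carrier W \<Longrightarrow> w \<in> carrier W \<Longrightarrow> \<psi> (v \<oplus>\<^bsub>W\<^esub> w) = \<psi> v * \<psi> w"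
      using separating_character[OF W.a_comm_group, of "g x"] gx gW[OF xM] by auto
    define \<Phi> :: "'w \<Rightarrow> ('r, 'm) universe"
      where "\<Phi> = (\<lambda>w m r. if r \<in> carrier R then \<psi> (r \<odot>\<^bsub>W\<^esub> w) else 1)"
    define E :: "('r, ('r, 'm) universe) module"
      where "E = \<lparr>carrier = {}, mult = undefined, one = undefined, zero = (\<lambda>m r. 1),
        add = (\<lambda>p q m r. p m r * q m r),
        smult = (\<lambda>a p m r. if r \<in> carrier R then p m (a \<otimes>\<^bsub>R\<^esub> r) else 1)\<rparr>"
    define W' where "W' = E\<lparr>carrier := \<Phi> ` carrier W\<rparr>"
    have Phi_add: "\<Phi> (v \<oplus>\<^bsub>W\<^esub> w) = \<Phi> v \<oplus>\<^bsub>E\<^esub> \<Phi> w" if "v \<in> carrier W" "w \<in> carrier W" for v w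
      using that by (auto simp: \<Phi>_def E_def fun_eq_iff W.smult_r_distr psi_add)
    have Phi_smult: "\<Phi> (a \<odot>\<^bsub>W\<^esub> w) = a \<odot>\<^bsub>E\<^esub> \<Phi> w" if "a \<in> carrier R" "w \<in> carrier W" for a w
      using that by (auto simp: \<Phi>_def E_def fun_eq_iff W.smult_assoc)
    have smult0: "r \<odot>\<^bsub>W\<^esub> \<zero>\<^bsub>W\<^esub> = \<zero>\<^bsub>W\<^esub>" if "r \<in> carrier R" for r
      using W.smult_r_distr[OF that W.zero_closed W.zero_closed] that
      by (metis W.l_zero W.add.l_cancel_one' W.zero_closed W.smult_closed)
    have Phi_zero: "\<Phi> \<zero>\<^bsub>W\<^esub> = \<zero>\<^bsub>E\<^esub>" by (auto simp: \<Phi>_def E_def fun_eq_iff smult0 psi0)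
    have W': "right_module R W'"
      unfolding W'_def by (rule right_module_image[OF W Phi_add Phi_smult Phi_zero])
    have Phi: "\<Phi> \<in> right_module_hom R W W'"
      unfolding right_module_hom_def W'_def using Phi_add Phi_smult by auto
    have sup': "superfluous R (\<Phi> ` N) W'"
      by (rule superfluous_image[OF W W' Phi _ sup]) (simp add: W'_def)
    hence N': "submodule (\<Phi> ` N) R W'" unfolding superfluous_def by blast
    define V' where "V' = sub_module W' (\<Phi> ` N)"
    have V': "right_module R V'" unfolding V'_def by (rule right_module_sub_module[OF W' N'])
    have "module_isomorphic R V' (sub_module W' (\<Phi> ` N))"
      unfolding module_isomorphic_def V'_def right_module_hom_def
      by (rule bexI[of _ id]) auto
    hence "small_module TYPE(('r, 'm) universe) R V'"
      unfolding small_module_def using V' W' sup' by blast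
    moreover have "(\<lambda>m. \<Phi> (g m)) \<in> right_module_hom R M V'"
      unfolding right_module_hom_def V'_def W'_def
      using gN gW by (auto simp: g_add g_smult Phi_add Phi_smult)
    ultimately have "\<Phi> (g x) = \<zero>\<^bsub>V'\<^esub>" using x unfolding Z_bar_def by blast
    hence "\<Phi> (g x) undefined \<one>\<^bsub>R\<^esub> = 1" unfolding V'_def W'_def E_def by simp
    hence "\<psi> (g x) = 1" unfolding \<Phi>_def using gW[OF xM] by simp
    thus False using psi by blast
  qed
  thus "x \<in> Z_bar TYPE('w) R M" using xM unfolding Z_bar_def by blast
qed

subsection \<open>Singular modules on an arbitrary type\<close>

lemma submodule_sum_add:
  assumes M: "right_module R M" and S: "\<And>N. N \<in> S \<Longrightarrow> submodule N R M"
    and x: "x \<in> submodule_sum M S" and y: "y \<in> submodule_sum M S"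
  shows "x \<oplus>\<^bsub>M\<^esub> y \<in> submodule_sum M S"
proof -
  interpret M: right_module R M by fact
  have S': "N \<subseteq> carrier M" "\<zero>\<^bsub>M\<^esub> \<in> N" "\<And>a b. a \<in> N \<Longrightarrow> b \<in> N \<Longrightarrow> a \<oplus>\<^bsub>M\<^esub> b \<in> N" if "N \<in> S" for N
    using S[OF that] unfolding submodule_iff[OF M] by blast+
  obtain g A where A: "finite A" "A \<subseteq> S" "\<And>N. N \<in> A \<Longrightarrow> g N \<in> N" "x = finsum M g A"
    using x unfolding submodule_sum_def by auto
  obtain h B where B: "finite B" "B \<subseteq> S" "\<And>N. N \<in> B \<Longrightarrow> h N \<in> N" "y = finsum M h B"
    using y unfolding submodule_sum_def by auto
  define g' where "g' N = (if N \<in> A then g N else \<zero>\<^bsub>M\<^esub>)" for N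
  define h' where "h' N = (if N \<in> B then h N else \<zero>\<^bsub>M\<^esub>)" for N
  have mem: "g' N \<in> N" "h' N \<in> N" if "N \<in> A \<union> B" for N
    using that A B S' unfolding g'_def h'_def by auto
  have car: "g' \<in> A \<union> B \<rightarrow> carrier M" "h' \<in> A \<union> B \<rightarrow> carrier M"
    using mem A(2) B(2) S'(1) by blast+
  have "finsum M g A = finsum M g' (A \<union> B)"
    by (rule M.add.finprod_mono_neutral_cong_left) (use A B car in \<open>auto simp: g'_def\<close>)
  moreover have "finsum M h B = finsum M h' (A \<union> B)"
    by (rule M.add.finprod_mono_neutral_cong_left) (use A B car in \<open>auto simp: h'_def\<close>)
  ultimately have "x \<oplus>\<^bsub>M\<^esub> y = finsum M (\<lambda>N. g' N \<oplus>\<^bsub>M\<^esub> h' N) (A \<union> B)"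
    using M.finsum_addf[OF car] A B by simp
  moreover have "\<forall>N\<in>A \<union> B. g' N \<oplus>\<^bsub>M\<^esub> h' N \<in> N" using mem S'(3) A(2) B(2) by blast
  ultimately show ?thesis
    unfolding submodule_sum_def using A B
    by (intro CollectI exI[of _ "\<lambda>N. g' N \<oplus>\<^bsub>M\<^esub> h' N"] exI[of _ "A \<union> B"]) simp
qed

lemma submodule_sum_mem:
  assumes M: "right_module R M" and N: "N \<in> S" "submodule N R M" and x: "x \<in> N"
  shows "x \<in> submodule_sum M S"
proof -
  interpret M: right_module R M by fact
  have "x \<in> carrier M" using N x unfolding submodule_iff[OF M] by blast
  hence "x = finsum M (\<lambda>_. x) {N}" by simp
  thus ?thesis unfolding submodule_sum_def using N x
    by (intro CollectI exI[of _ "\<lambda>_. x"] exI[of _ "{N}"]) simp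
qed

lemma right_module_hom_image:
  assumes "right_module R M" "right_module R N" "f \<in> right_module_hom R M N"
  shows "submodule (f ` carrier M) R N"
proof (rule submodule_image[OF assms])
  interpret M: right_module R M by (rule assms(1))
  show "submodule (carrier M) R M" unfolding submodule_iff[OF assms(1)] by auto
qed

lemma module_isomorphic_quotient:
  assumes A: "right_module R A" and B: "right_module R B" and p: "p \<in> right_module_hom R A B"
    and onto: "carrier B = p ` carrier A"
  shows "module_isomorphic R B (quotient_module A {a \<in> carrier A. p a = \<zero>\<^bsub>B\<^esub>})"
proof -
  interpret A: right_module R A by fact
  interpret B: right_module R B by fact
  define K where "K = {a \<in> carrier A. p a = \<zero>\<^bsub>B\<^esub>}"
  define g where "g v = {b \<in> carrier A. p b = v}" for v
  have pc: "p a \<in> carrier B" if "a \<in> carrier A" for a using that onto by blast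
  have padd: "p (a \<oplus>\<^bsub>A\<^esub> b) = p a \<oplus>\<^bsub>B\<^esub> p b" if "a \<in> carrier A" "b \<in> carrier A" for a b
    using that p unfolding right_module_hom_def by blast
  have psm: "p (r \<odot>\<^bsub>A\<^esub> a) = r \<odot>\<^bsub>B\<^esub> p a" if "r \<in> carrier R" "a \<in> carrier A" for r a
    using that p unfolding right_module_hom_def by blast
  note pm = right_module_hom_minus[OF A B p]
  have coset: "K +>\<^bsub>A\<^esub> a = g (p a)" if a: "a \<in> carrier A" for a
  proof (intro equalityI subsetI)
    fix b assume "b \<in> K +>\<^bsub>A\<^esub> a"
    thus "b \<in> g (p a)" using a pc by (auto simp: K_def g_def a_r_coset_def' padd)
  next
    fix b assume "b \<in> g (p a)"
    hence b: "b \<in> carrier A" "p b = p a" by (auto simp: g_def)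
    hence "b \<oplus>\<^bsub>A\<^esub> \<ominus>\<^bsub>A\<^esub> a \<in> K" using a pc by (simp add: K_def padd pm B.r_neg)
    moreover have "b = (b \<oplus>\<^bsub>A\<^esub> \<ominus>\<^bsub>A\<^esub> a) \<oplus>\<^bsub>A\<^esub> a" using a b by (simp add: A.a_assoc A.l_neg)
    ultimately show "b \<in> K +>\<^bsub>A\<^esub> a" by (auto simp: a_r_coset_def')
  qed
  have car: "carrier (quotient_module A K) = g ` carrier B"
    unfolding quotient_module_def A_RCOSETS_def' onto by (auto simp: coset)
  have hom: "g \<in> right_module_hom R B (quotient_module A K)"
    unfolding right_module_hom_def
  proof (intro CollectI conjI ballI)
    show "g \<in> carrier B \<rightarrow> carrier (quotient_module A K)" unfolding car by auto
    fix v w assume "v \<in> carrier B" "w \<in> carrier B"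
    then obtain a b where a: "a \<in> carrier A" "v = p a" and b: "b \<in> carrier A" "w = p b"
      unfolding onto by auto
    have "g (v \<oplus>\<^bsub>B\<^esub> w) = g v <+>\<^bsub>A\<^esub> g w"
    proof (intro equalityI subsetI)
      fix z assume "z \<in> g (v \<oplus>\<^bsub>B\<^esub> w)"
      hence z: "z \<in> carrier A" "p z = p a \<oplus>\<^bsub>B\<^esub> p b" using a b by (auto simp: g_def)
      have "\<ominus>\<^bsub>A\<^esub> a \<oplus>\<^bsub>A\<^esub> z \<in> g w" using z a b pc by (simp add: g_def padd pm B.r_neg1)
      moreover have "z = a \<oplus>\<^bsub>A\<^esub> (\<ominus>\<^bsub>A\<^esub> a \<oplus>\<^bsub>A\<^esub> z)" using a z by (simp add: A.r_neg2)
      moreover have "a \<in> g v" using a by (simp add: g_def)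
      ultimately show "z \<in> g v <+>\<^bsub>A\<^esub> g w" unfolding set_add_def' by blast
    next
      fix z assume "z \<in> g v <+>\<^bsub>A\<^esub> g w"
      thus "z \<in> g (v \<oplus>\<^bsub>B\<^esub> w)" by (auto simp: set_add_def' g_def padd)
    qed
    thus "g (v \<oplus>\<^bsub>B\<^esub> w) = g v \<oplus>\<^bsub>quotient_module A K\<^esub> g w" by (simp add: quotient_module_def)
  next
    fix r v assume r: "r \<in> carrier R" and "v \<in> carrier B"
    then obtain a where a: "a \<in> carrier A" "v = p a" unfolding onto by auto
    have "K +>\<^bsub>A\<^esub> (r \<odot>\<^bsub>A\<^esub> x) = g (r \<odot>\<^bsub>B\<^esub> v)" if "x \<in> g v" for x
      using that r coset[of "r \<odot>\<^bsub>A\<^esub> x"] by (auto simp: g_def psm)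
    moreover have "a \<in> g v" using a by (simp add: g_def)
    ultimately have "(\<Union>x\<in>g v. K +>\<^bsub>A\<^esub> (r \<odot>\<^bsub>A\<^esub> x)) = g (r \<odot>\<^bsub>B\<^esub> v)" by auto
    thus "g (r \<odot>\<^bsub>B\<^esub> v) = r \<odot>\<^bsub>quotient_module A K\<^esub> g v" by (simp add: quotient_module_def)
  qed
  have "inj_on g (carrier B)"
  proof (rule inj_onI)
    fix v w assume "v \<in> carrier B" "g v = g w"
    then obtain a where "a \<in> g v" unfolding onto g_def by auto
    thus "v = w" using \<open>g v = g w\<close> unfolding g_def by auto
  qed
  hence "bij_betw g (carrier B) (carrier (quotient_module A K))"
    unfolding car by (simp add: bij_betw_def)
  thus ?thesis using hom unfolding module_isomorphic_def K_def by blast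
qed

definition module_copy :: "('m \<Rightarrow> 'u) \<Rightarrow> ('r, 'm, 'y) module_scheme \<Rightarrow> ('r, 'u) module"
  where "module_copy i M = \<lparr>carrier = i ` carrier M, mult = undefined, one = undefined,
    zero = i \<zero>\<^bsub>M\<^esub>, add = (\<lambda>p q. i (inv_into UNIV i p \<oplus>\<^bsub>M\<^esub> inv_into UNIV i q)), smult = (\<lambda>a p. i (a \<odot>\<^bsub>M\<^esub> inv_into UNIV i p))\<rparr>"

lemma module_copy:
  assumes M: "right_module R M" and i: "inj i"
  shows "right_module R (module_copy i M)" "i \<in> right_module_hom R M (module_copy i M)"
    "inv_into UNIV i \<in> right_module_hom R (module_copy i M) M"
proof -
  interpret M: right_module R M by fact
  have "right_module R ((module_copy i M)\<lparr>carrier := i ` carrier M\<rparr>)"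
    by (rule right_module_image[OF M]) (use i in \<open>auto simp: module_copy_def\<close>)
  thus "right_module R (module_copy i M)" by (simp add: module_copy_def)
  show "i \<in> right_module_hom R M (module_copy i M)"
    "inv_into UNIV i \<in> right_module_hom R (module_copy i M) M"
    using i by (auto simp: right_module_hom_def module_copy_def)
qed

definition regular_module :: "('r, 'x) ring_scheme \<Rightarrow> ('r, 'r) module"
  where "regular_module R = \<lparr>carrier = carrier R, mult = undefined, one = undefined,
    zero = \<zero>\<^bsub>R\<^esub>, add = add R, smult = (\<lambda>a x. x \<otimes>\<^bsub>R\<^esub> a)\<rparr>"

lemma regular_module:
  assumes "ring R"
  shows "right_module R (regular_module R)"
proof -
  interpret ring R by fact
  show ?thesis
  proof (intro right_module.intro right_module_axioms.intro abelian_groupI)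
    show "ring R" by fact
    show "\<exists>y\<in>carrier (regular_module R). y \<oplus>\<^bsub>regular_module R\<^esub> x = \<zero>\<^bsub>regular_module R\<^esub>"
      if "x \<in> carrier (regular_module R)" for x
      using that by (auto simp: regular_module_def intro!: bexI[of _ "\<ominus>\<^bsub>R\<^esub> x"] l_neg)
  qed (auto simp: regular_module_def a_assoc l_distr r_distr m_assoc intro: a_comm)
qed

lemma right_module_smult_hom:
  assumes M: "right_module R M" and y: "y \<in> carrier M"
  shows "(\<lambda>a. a \<odot>\<^bsub>M\<^esub> y) \<in> right_module_hom R (regular_module R) M"
proof -
  interpret M: right_module R M by fact
  show ?thesis using y
    by (auto simp: right_module_hom_def regular_module_def M.smult_l_distr M.smult_assoc)
qed

lemma right_module_hom_comp:
  assumes "f \<in> right_module_hom R A B" "g \<in> right_module_hom R B C"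
  shows "(\<lambda>x. g (f x)) \<in> right_module_hom R A C"
proof -
  have "f x \<in> carrier B" if "x \<in> carrier A" for x
    using assms(1) that unfolding right_module_hom_def by blast
  thus ?thesis using assms unfolding right_module_hom_def by auto
qed

lemma quotient_smult_coset:
  assumes L: "right_module R L" and K: "submodule K R L" and l: "l \<in> carrier L"
    and a: "a \<in> carrier R" and al: "a \<odot>\<^bsub>L\<^esub> l \<in> K"
  shows "a \<odot>\<^bsub>quotient_module L K\<^esub> (K +>\<^bsub>L\<^esub> l) = K"
proof -
  interpret L: right_module R L by fact
  note K' = K[unfolded submodule_iff[OF L]]
  have KL: "k \<in> carrier L" if "k \<in> K" for k using K' that by blast
  have K_coset: "K +>\<^bsub>L\<^esub> k = K" if k: "k \<in> K" for k
  proof (intro equalityI subsetI)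
    fix x assume "x \<in> K +>\<^bsub>L\<^esub> k" thus "x \<in> K" using K' k by (auto simp: a_r_coset_def')
  next
    fix x assume x: "x \<in> K"
    hence "x \<oplus>\<^bsub>L\<^esub> \<ominus>\<^bsub>L\<^esub> k \<in> K" using K' k by blast
    moreover have "x = (x \<oplus>\<^bsub>L\<^esub> \<ominus>\<^bsub>L\<^esub> k) \<oplus>\<^bsub>L\<^esub> k" using KL x k by (simp add: L.a_assoc L.l_neg)
    ultimately show "x \<in> K +>\<^bsub>L\<^esub> k" by (auto simp: a_r_coset_def')
  qed
  have "a \<odot>\<^bsub>L\<^esub> x \<in> K" if "x \<in> K +>\<^bsub>L\<^esub> l" for x
    using that K' al a l KL by (auto simp: a_r_coset_def' L.smult_r_distr)
  moreover have "l \<in> K +>\<^bsub>L\<^esub> l"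
    unfolding a_r_coset_def' using K' l by (auto intro!: bexI[of _ "\<zero>\<^bsub>L\<^esub>"])
  ultimately have "(\<Union>x\<in>K +>\<^bsub>L\<^esub> l. K +>\<^bsub>L\<^esub> (a \<odot>\<^bsub>L\<^esub> x)) = K" using K_coset by auto
  thus ?thesis by (simp add: quotient_module_def)
qed

text \<open>
  An element \<open>y\<close> of the image of a singular module has an essential annihilator in \<open>R\<close>; hence the
  cyclic module \<open>y \<cdot> R\<close>, a quotient of \<open>R\<close>, is singular, and it has a copy in the universe.
\<close>

theorem Z_sub_universe:
  fixes R :: "('r, 'x) ring_scheme" and M :: "('r, 'm, 'y) module_scheme"
  assumes M: "right_module R M"
  shows "Z_sub TYPE('w) R M \<subseteq> Z_sub TYPE(('r, 'm) universe) R M"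
proof
  interpret M: right_module R M by fact
  define S where "S = {f ` carrier U |f (U :: ('r, ('r, 'm) universe) module).
    singular_module TYPE(('r, 'm) universe) R U \<and> f \<in> right_module_hom R U M}"
  have Z: "Z_sub TYPE(('r, 'm) universe) R M = submodule_sum M S"
    unfolding Z_sub_def S_def by simp
  have S: "submodule N R M" if "N \<in> S" for N
    using that right_module_hom_image[OF _ M] unfolding S_def singular_module_def by blast
  have key: "f u \<in> submodule_sum M S"
    if U: "singular_module TYPE('w) R U" and f: "f \<in> right_module_hom R U M" and u: "u \<in> carrier U"
    for U :: "('r, 'w) module" and f u
  proof -
    obtain L :: "('r, 'w) module" and K \<phi> where U': "right_module R U" and L: "right_module R L"
      and ess: "essential R K L" and phi: "\<phi> \<in> right_module_hom R U (quotient_module L K)"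
      and bij: "bij_betw \<phi> (carrier U) (carrier (quotient_module L K))"
      using U unfolding singular_module_def module_isomorphic_def by auto
    interpret U: right_module R U by fact
    interpret L: right_module R L by fact
    have K: "submodule K R L" using ess unfolding essential_def by blast
    have "\<phi> u \<in> carrier (quotient_module L K)" using bij u by (auto simp: bij_betw_def)
    then obtain l where l: "l \<in> carrier L" "\<phi> u = K +>\<^bsub>L\<^esub> l"
      unfolding quotient_module_def A_RCOSETS_def' by auto
    have phi_K: "\<phi> (a \<odot>\<^bsub>U\<^esub> u) = K" if "a \<in> carrier R" "a \<odot>\<^bsub>L\<^esub> l \<in> K" for a
    proof -
      have "\<phi> (a \<odot>\<^bsub>U\<^esub> u) = a \<odot>\<^bsub>quotient_module L K\<^esub> \<phi> u"
        using phi that(1) u unfolding right_module_hom_def by blast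
      thus ?thesis using quotient_smult_coset[OF L K l(1) that] l(2) by simp
    qed
    have K0: "\<zero>\<^bsub>L\<^esub> \<in> K" using K unfolding submodule_iff[OF L] by blast
    have smult0: "\<zero>\<^bsub>R\<^esub> \<odot>\<^bsub>N\<^esub> v = \<zero>\<^bsub>N\<^esub>" if "right_module R N" "v \<in> carrier N"
      for v and N :: "('r, 'w) module"
      using right_module_hom_zero[OF regular_module[OF M.R.ring_axioms] that(1)
          right_module_smult_hom[OF that]] by (simp add: regular_module_def)
    have kill: "a \<odot>\<^bsub>U\<^esub> u = \<zero>\<^bsub>U\<^esub>" if "a \<in> carrier R" "a \<odot>\<^bsub>L\<^esub> l \<in> K" for a
    proof -
      have "\<phi> (\<zero>\<^bsub>R\<^esub> \<odot>\<^bsub>U\<^esub> u) = K" using phi_K[of "\<zero>\<^bsub>R\<^esub>"] smult0[OF L l(1)] K0 by simp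
      hence "\<phi> (a \<odot>\<^bsub>U\<^esub> u) = \<phi> \<zero>\<^bsub>U\<^esub>" using phi_K[OF that] smult0[OF U' u] by simp
      thus ?thesis using bij that u unfolding bij_betw_def inj_on_def by blast
    qed
    define y where "y = f u"
    have y: "y \<in> carrier M" using f u unfolding y_def right_module_hom_def by blast
    define p where "p = (\<lambda>a. a \<odot>\<^bsub>M\<^esub> y)"
    have RR: "right_module R (regular_module R)" by (rule regular_module[OF M.R.ring_axioms])
    have p: "p \<in> right_module_hom R (regular_module R) M"
      unfolding p_def by (rule right_module_smult_hom[OF M y])
    define C where "C = sub_module M (p ` carrier (regular_module R))"
    have C: "right_module R C"
      unfolding C_def by (rule right_module_sub_module[OF M right_module_hom_image[OF RR M p]])
    have pC: "p \<in> right_module_hom R (regular_module R) C"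
      using p unfolding C_def right_module_hom_def by auto
    define i :: "'m \<Rightarrow> ('r, 'm) universe" where "i = (\<lambda>m m' r. if m' = m then 2 else 1)"
    define j :: "'r \<Rightarrow> ('r, 'm) universe" where "j = (\<lambda>s m r. if r = s then 2 else 1)"
    have i: "inj i"
    proof (rule injI)
      fix m n assume "i m = i n"
      hence "i m m undefined = i n m undefined" by simp
      thus "m = n" unfolding i_def by (simp split: if_splits)
    qed
    have j: "inj j"
    proof (rule injI)
      fix s t assume "j s = j t"
      hence "j s undefined s = j t undefined s" by simp
      thus "s = t" unfolding j_def by (simp split: if_splits)
    qed
    define U0 where "U0 = module_copy i C"
    define L0 where "L0 = module_copy j (regular_module R)"
    note U0 = module_copy[OF C i, folded U0_def] and L0 = module_copy[OF RR j, folded L0_def]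
    define p0 where "p0 = (\<lambda>t. i (p (inv_into UNIV j t)))"
    have p0: "p0 \<in> right_module_hom R L0 U0"
      unfolding p0_def
      by (rule right_module_hom_comp[OF right_module_hom_comp[OF L0(3) pC] U0(2)])
    have onto: "carrier U0 = p0 ` carrier L0"
      unfolding p0_def U0_def L0_def module_copy_def C_def using j by (auto simp: image_image)
    define K0 where "K0 = {t \<in> carrier L0. p0 t = \<zero>\<^bsub>U0\<^esub>}"
    define q where "q = (\<lambda>t. inv_into UNIV j t \<odot>\<^bsub>L\<^esub> l)"
    have q: "q \<in> right_module_hom R L0 L"
      unfolding q_def
      by (rule right_module_hom_comp[OF L0(3) right_module_smult_hom[OF L l(1)]])
    have qK: "t \<in> K0" if t: "t \<in> carrier L0" and "q t \<in> K" for t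
    proof -
      have a: "inv_into UNIV j t \<in> carrier R"
        using t L0(3) unfolding right_module_hom_def regular_module_def by auto
      hence "inv_into UNIV j t \<odot>\<^bsub>U\<^esub> u = \<zero>\<^bsub>U\<^esub>" using kill that(2) unfolding q_def by blast
      moreover have "f (inv_into UNIV j t \<odot>\<^bsub>U\<^esub> u) = inv_into UNIV j t \<odot>\<^bsub>M\<^esub> y"
        using f a u unfolding y_def right_module_hom_def by blast
      ultimately have "p (inv_into UNIV j t) = \<zero>\<^bsub>M\<^esub>"
        using right_module_hom_zero[OF U' M f] unfolding p_def by simp
      thus ?thesis using t unfolding K0_def p0_def U0_def module_copy_def C_def by simp
    qed
    interpret L0: right_module R L0 by (rule L0(1))
    interpret U0: right_module R U0 by (rule U0(1))
    have "submodule {\<zero>\<^bsub>U0\<^esub>} R U0"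
      unfolding submodule_iff[OF U0(1)]
      by (auto) (metis U0.smult_r_distr U0.l_zero U0.add.l_cancel_one' U0.zero_closed U0.smult_closed)
    hence K0s: "submodule K0 R L0"
      using submodule_vimage[OF L0(1) U0(1) p0, of "{\<zero>\<^bsub>U0\<^esub>}"] unfolding K0_def by simp
    have "essential R K0 L0"
      unfolding essential_def
    proof (intro conjI allI impI)
      show "submodule K0 R L0" by fact
      fix H assume H: "submodule H R L0" and int: "K0 \<inter> H = {\<zero>\<^bsub>L0\<^esub>}"
      have HL: "H \<subseteq> carrier L0" and H0: "\<zero>\<^bsub>L0\<^esub> \<in> H"
        using H unfolding submodule_iff[OF L0(1)] by blast+
      have in0: "t = \<zero>\<^bsub>L0\<^esub>" if "t \<in> H" "q t \<in> K" for t using qK int HL that by blast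
      have qH: "submodule (q ` H) R L" by (rule submodule_image[OF L0(1) L q H])
      have q0: "q \<zero>\<^bsub>L0\<^esub> = \<zero>\<^bsub>L\<^esub>" by (rule right_module_hom_zero[OF L0(1) L q])
      have "K \<inter> q ` H = {\<zero>\<^bsub>L\<^esub>}"
      proof (intro equalityI subsetI)
        fix z assume "z \<in> K \<inter> q ` H"
        then obtain t where "t \<in> H" "q t \<in> K" "z = q t" by auto
        thus "z \<in> {\<zero>\<^bsub>L\<^esub>}" using in0[of t] q0 by simp
      next
        fix z assume "z \<in> {\<zero>\<^bsub>L\<^esub>}"
        thus "z \<in> K \<inter> q ` H" using \<open>\<zero>\<^bsub>L\<^esub> \<in> K\<close> H0 q0 by (auto intro: rev_image_eqI)
      qed
      hence "q ` H = {\<zero>\<^bsub>L\<^esub>}" using ess qH unfolding essential_def by blast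
      hence "q t \<in> K" if "t \<in> H" for t
        using imageI[OF that, of q] \<open>\<zero>\<^bsub>L\<^esub> \<in> K\<close> by simp
      hence "H \<subseteq> {\<zero>\<^bsub>L0\<^esub>}" using in0 by auto
      thus "H = {\<zero>\<^bsub>L0\<^esub>}" using H0 by auto
    qed
    moreover have "module_isomorphic R U0 (quotient_module L0 K0)"
      unfolding K0_def by (rule module_isomorphic_quotient[OF L0(1) U0(1) p0 onto])
    ultimately have sing: "singular_module TYPE(('r, 'm) universe) R U0"
      unfolding singular_module_def using U0(1) L0(1) by blast
    have inv: "inv_into UNIV i \<in> right_module_hom R U0 M"
    proof -
      have "(\<lambda>x. x) \<in> right_module_hom R C M"
        using p unfolding right_module_hom_def C_def by auto
      from right_module_hom_comp[OF U0(3) this] show ?thesis by simp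
    qed
    have "inv_into UNIV i ` carrier U0 \<in> S" unfolding S_def using sing inv by blast
    moreover have "y \<in> inv_into UNIV i ` carrier U0"
    proof -
      have "p \<one>\<^bsub>R\<^esub> = y" unfolding p_def using y by simp
      hence "y \<in> carrier C" unfolding C_def regular_module_def by force
      thus ?thesis unfolding U0_def module_copy_def using i by (force simp: image_image)
    qed
    ultimately show ?thesis using submodule_sum_mem[OF M _ S] unfolding y_def by blast
  qed
  fix x assume "x \<in> Z_sub TYPE('w) R M"
  then obtain g A where A: "finite A" and g: "\<forall>N\<in>A. g N \<in> N" and x: "x = finsum M g A"
    and AS: "A \<subseteq> {f ` carrier U |f (U :: ('r, 'w) module).
      singular_module TYPE('w) R U \<and> f \<in> right_module_hom R U M}"
    unfolding Z_sub_def submodule_sum_def by auto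
  have gS: "g N \<in> submodule_sum M S" if "N \<in> A" for N
  proof -
    obtain f and U :: "('r, 'w) module" where fU: "N = f ` carrier U"
      "singular_module TYPE('w) R U" "f \<in> right_module_hom R U M" using AS \<open>N \<in> A\<close> by blast
    then obtain u where "u \<in> carrier U" "g N = f u" using g \<open>N \<in> A\<close> by auto
    thus ?thesis using key[OF fU(2,3)] by simp
  qed
  have sub: "submodule_sum M S \<subseteq> carrier M"
  proof
    fix z assume "z \<in> submodule_sum M S"
    then obtain h B where B: "B \<subseteq> S" "\<forall>N\<in>B. h N \<in> N" "z = finsum M h B"
      unfolding submodule_sum_def by auto
    have "h N \<in> carrier M" if "N \<in> B" for N
      using B that S[of N] unfolding submodule_iff[OF M] by blast
    hence "h \<in> B \<rightarrow> carrier M" by blast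
    thus "z \<in> carrier M" using B by simp
  qed
  have zero: "\<zero>\<^bsub>M\<^esub> \<in> submodule_sum M S"
    unfolding submodule_sum_def by (auto intro!: exI[of _ "{}"])
  have "finsum M g A \<in> submodule_sum M S"
    using A gS
  proof (induction A rule: finite_induct)
    case empty thus ?case using zero by simp
  next
    case (insert N F)
    have "finsum M g (insert N F) = g N \<oplus>\<^bsub>M\<^esub> finsum M g F"
      by (rule M.finsum_insert) (use insert sub in auto)
    thus ?case using submodule_sum_add[OF M S] insert by simp
  qed
  thus "x \<in> Z_sub TYPE(('r, 'm) universe) R M" using x Z by simp
qed

end

theory Submission
  imports Defs
begin

text \<open>
  If the common kernel \<open>N\<close> of a family is essential in \<open>D\<close>, then each member \<open>f\<close> maps \<open>D\<close> onto a
  quotient of \<open>D\<close> by an essential submodule, so \<open>f D \<subseteq> Z(M) = 0\<close> and \<open>N = D\<close>. Dually, if the image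
  sum \<open>L\<close> lies above \<open>D\<close>, then each \<open>f\<close> induces a map from \<open>M\<close> to the small module \<open>L / D\<close>, which
  vanishes on \<open>Z_bar M = M\<close>, so \<open>L = D\<close>.
\<close>

text \<open>A submodule meeting \<open>K\<close> only in zero also meets the smaller
  \<open>N\<close> only in zero. This allows replacing an essential submodule killed by a map with
  the full kernel of that map.\<close>

lemma essential_mono:
  assumes "essential R N D" "submodule K R D" "N \<subseteq> K" "right_module R D"
  shows "essential R K D"
  unfolding essential_def
proof (intro conjI allI impI)
  fix X assume X: "submodule X R D" and KX: "K \<inter> X = {\<zero>\<^bsub>D\<^esub>}"
  have "submodule N R D" using assms(1) unfolding essential_def by blast
  hence "\<zero>\<^bsub>D\<^esub> \<in> N" "\<zero>\<^bsub>D\<^esub> \<in> X" using X unfolding submodule_iff[OF assms(4)] by blast+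
  hence "N \<inter> X = {\<zero>\<^bsub>D\<^esub>}" using KX assms(3) by blast
  thus "X = {\<zero>\<^bsub>D\<^esub>}" using assms(1) X unfolding essential_def by blast
qed (fact assms(2))

lemma submodule_zero:
  assumes M: "right_module R M"
  shows "submodule {\<zero>\<^bsub>M\<^esub>} R M"
proof -
  interpret M: right_module R M by fact
  have "a \<odot>\<^bsub>M\<^esub> \<zero>\<^bsub>M\<^esub> = \<zero>\<^bsub>M\<^esub>" if "a \<in> carrier R" for a
    using M.smult_r_distr[OF that M.zero_closed M.zero_closed] that
    by (metis M.l_zero M.add.l_cancel_one' M.zero_closed M.smult_closed)
  thus ?thesis unfolding submodule_iff[OF M] by auto
qed

text \<open>Copying along the identity only drops the record extensions, as the type of \<open>Z_sub\<close> requires.\<close>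

lemma image_subset_Z_sub:
  fixes R :: "('r, 'x) ring_scheme" and A :: "('r, 'm, 'y) module_scheme"
    and M :: "('r, 'm, 'z) module_scheme"
  assumes A: "right_module R A" and M: "right_module R M"
    and ess: "essential R N A" and f: "f \<in> right_module_hom R A M"
    and kill: "\<And>x. x \<in> N \<Longrightarrow> f x = \<zero>\<^bsub>M\<^esub>"
  shows "f ` carrier A \<subseteq> Z_sub TYPE('m) R M"
proof -
  \<comment> \<open>The codomain is cut down to the image, so that \<open>f\<close> becomes onto and
    the first isomorphism theorem presents the image as \<open>A\<close> modulo a kernel.\<close>
  define B where "B = sub_module M (f ` carrier A)"
  have fA: "submodule (f ` carrier A) R M" by (rule right_module_hom_image[OF A M f])
  have B: "right_module R B" unfolding B_def by (rule right_module_sub_module[OF M fA])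
  define A' where "A' = module_copy id A"
  define B' where "B' = module_copy id B"
  note A' = module_copy[OF A inj_on_id, folded A'_def]
    and B' = module_copy[OF B inj_on_id, folded B'_def]
  have fB: "f \<in> right_module_hom R A B" using f unfolding B_def right_module_hom_def by auto
  have f': "f \<in> right_module_hom R A' B'"
    using right_module_hom_comp[OF right_module_hom_comp[OF A'(3) fB] B'(2)] by simp
  have onto: "carrier B' = f ` carrier A'" unfolding A'_def B'_def B_def module_copy_def by simp
  have zero: "\<zero>\<^bsub>A'\<^esub> = \<zero>\<^bsub>A\<^esub>" "\<zero>\<^bsub>B'\<^esub> = \<zero>\<^bsub>M\<^esub>"
    unfolding A'_def B'_def B_def module_copy_def by simp_all
  \<comment> \<open>The identity is a homomorphism in both directions between \<open>A\<close> and
    its copy, so taking images under it shows that both have the same submodules; essentiality then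
    carries over.\<close>
  have sub: "submodule X R A' \<longleftrightarrow> submodule X R A" for X
    using submodule_image[OF A A'(1) A'(2), of X] submodule_image[OF A'(1) A A'(3), of X] by auto
  have ess': "essential R N A'" using ess unfolding essential_def sub zero .
  \<comment> \<open>This kernel contains the essential \<open>N\<close>, hence is essential, and the
    quotient by it, isomorphic to the image of \<open>f\<close>, is singular.\<close>
  define K where "K = {x \<in> carrier A'. f x = \<zero>\<^bsub>B'\<^esub>}"
  have K: "submodule K R A'"
    using submodule_vimage[OF A'(1) B'(1) f' submodule_zero[OF B'(1)]] unfolding K_def by simp
  have "N \<subseteq> carrier A'"
    using ess' unfolding essential_def submodule_iff[OF A'(1)] by blast
  hence "N \<subseteq> K" using kill zero unfolding K_def by auto
  hence "essential R K A'" using essential_mono[OF ess' K _ A'(1)] by blast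
  moreover have "module_isomorphic R B' (quotient_module A' K)"
    unfolding K_def by (rule module_isomorphic_quotient[OF A'(1) B'(1) f' onto])
  ultimately have sing: "singular_module TYPE('m) R B'"
    unfolding singular_module_def using A'(1) B'(1) by blast
  \<comment> \<open>The inclusion exhibits the image of \<open>f\<close> as the image of a singular
    module, hence as one of the submodules summed in \<open>Z_sub\<close>.\<close>
  have "id \<in> right_module_hom R B M" using fA
    unfolding right_module_hom_def B_def submodule_iff[OF M] by auto
  from right_module_hom_comp[OF B'(3) this] have id: "id \<in> right_module_hom R B' M"
    by (simp add: id_def)
  have mem: "f ` carrier A \<in> {h ` carrier U |h (U :: ('r, 'm) module).
      singular_module TYPE('m) R U \<and> h \<in> right_module_hom R U M}"
    using sing id by (intro CollectI exI[of _ id] exI[of _ B'])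
      (simp add: B'_def B_def module_copy_def)
  show ?thesis unfolding Z_sub_def by (rule subsetI) (rule submodule_sum_mem[OF M mem fA])
qed

lemma non_singular_common_kernel:
  fixes R :: "('r, 'x) ring_scheme" and M :: "('r, 'm, 'y) module_scheme"
  assumes M: "right_module R M" and ns: "non_singular R M"
    and F: "F \<subseteq> right_module_hom R M M" and D: "submodule D R M"
    and ess: "essential R (common_kernel M F) (sub_module M D)"
  shows "common_kernel M F = D"
proof
  have DM: "right_module R (sub_module M D)" by (rule right_module_sub_module[OF M D])
  show "common_kernel M F \<subseteq> D"
    using ess unfolding essential_def submodule_iff[OF DM] by simp
  have Dc: "D \<subseteq> carrier M" using D unfolding submodule_iff[OF M] by blast
  have "f x = \<zero>\<^bsub>M\<^esub>" if f: "f \<in> F" and x: "x \<in> D" for f x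
  proof -
    have "f \<in> right_module_hom R (sub_module M D) M"
      using subsetD[OF F f] Dc unfolding right_module_hom_def by (auto simp: subset_iff)
    hence "f ` D \<subseteq> Z_sub TYPE('m) R M"
      using image_subset_Z_sub[OF DM M ess] f unfolding common_kernel_def by simp
    \<comment> \<open>The singular module found lives on \<open>'m\<close>, whereas
      \<open>non_singular\<close> refers to the fixed universe; \<open>Z_sub_universe\<close>
      bridges the two.\<close>
    thus ?thesis using Z_sub_universe[OF M, where 'w = 'm] ns x unfolding non_singular_def by blast
  qed
  thus "D \<subseteq> common_kernel M F" using Dc unfolding common_kernel_def by blast
qed

text \<open>The coset map is onto and respects the operations, so the module laws of the quotient
  are inherited from \<open>M\<close> through \<open>right_module_image\<close>. The last claim
  serves to turn the vanishing of a coset into membership in \<open>K\<close>.\<close>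

lemma quotient_map:
  assumes M: "right_module R M" and K: "submodule K R M"
  shows "right_module R (quotient_module M K)"
    and "(\<lambda>x. K +>\<^bsub>M\<^esub> x) \<in> right_module_hom R M (quotient_module M K)"
    and "\<And>x. x \<in> carrier M \<Longrightarrow> K +>\<^bsub>M\<^esub> x = K \<longleftrightarrow> x \<in> K"
proof -
  interpret M: right_module R M by fact
  note K' = K[unfolded submodule_iff[OF M]]
  have "subgroup K (add_monoid M)" using K unfolding submodule_def by blast
  hence "abelian_subgroup K M"
    by (intro abelian_subgroupI3 additive_subgroup.intro M.abelian_group_axioms)
  then interpret K: abelian_subgroup K M .
  have add: "K +>\<^bsub>M\<^esub> (x \<oplus>\<^bsub>M\<^esub> y) = (K +>\<^bsub>M\<^esub> x) \<oplus>\<^bsub>quotient_module M K\<^esub> (K +>\<^bsub>M\<^esub> y)"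
    if "x \<in> carrier M" "y \<in> carrier M" for x y
    using K.a_rcos_sum[OF that] by (simp add: quotient_module_def)
  have smult: "K +>\<^bsub>M\<^esub> (a \<odot>\<^bsub>M\<^esub> x) = a \<odot>\<^bsub>quotient_module M K\<^esub> (K +>\<^bsub>M\<^esub> x)"
    if a: "a \<in> carrier R" and x: "x \<in> carrier M" for a x
  proof -
    have "K +>\<^bsub>M\<^esub> (a \<odot>\<^bsub>M\<^esub> y) = K +>\<^bsub>M\<^esub> (a \<odot>\<^bsub>M\<^esub> x)" if y: "y \<in> K +>\<^bsub>M\<^esub> x" for y
    proof -
      \<comment> \<open>Representatives differ by some \<open>k\<close> in \<open>K\<close>, and
        \<open>a\<close> acting on \<open>k\<close> stays in \<open>K\<close>. Hence the union
        defining the scalar action is a nonempty union of equal cosets.\<close>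
      obtain k where k: "k \<in> K" "y = k \<oplus>\<^bsub>M\<^esub> x" using y by (auto simp: a_r_coset_def')
      hence kM: "k \<in> carrier M" using K' by blast
      have "a \<odot>\<^bsub>M\<^esub> y = a \<odot>\<^bsub>M\<^esub> k \<oplus>\<^bsub>M\<^esub> a \<odot>\<^bsub>M\<^esub> x"
        using k a x kM by (simp add: M.smult_r_distr)
      moreover have "a \<odot>\<^bsub>M\<^esub> k \<in> K" using K' a k by blast
      ultimately have "a \<odot>\<^bsub>M\<^esub> y \<in> K +>\<^bsub>M\<^esub> (a \<odot>\<^bsub>M\<^esub> x)"
        by (auto simp: a_r_coset_def')
      thus ?thesis using K.a_repr_independence' a x by simp
    qed
    moreover have "x \<in> K +>\<^bsub>M\<^esub> x" using x by (rule K.a_rcos_self)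
    ultimately have "(\<Union>y\<in>K +>\<^bsub>M\<^esub> x. K +>\<^bsub>M\<^esub> (a \<odot>\<^bsub>M\<^esub> y)) = K +>\<^bsub>M\<^esub> (a \<odot>\<^bsub>M\<^esub> x)"
      by blast
    thus ?thesis unfolding quotient_module_def by simp
  qed
  have zero: "K +>\<^bsub>M\<^esub> \<zero>\<^bsub>M\<^esub> = \<zero>\<^bsub>quotient_module M K\<^esub>"
    using K' by (simp add: quotient_module_def M.a_coset_add_zero)
  have car: "carrier (quotient_module M K) = (\<lambda>x. K +>\<^bsub>M\<^esub> x) ` carrier M"
    by (auto simp: quotient_module_def A_RCOSETS_def')
  have "(quotient_module M K)\<lparr>carrier := (\<lambda>x. K +>\<^bsub>M\<^esub> x) ` carrier M\<rparr> = quotient_module M K"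
    unfolding car[symmetric] by simp
  thus "right_module R (quotient_module M K)"
    using right_module_image[OF M add smult zero] by simp
  show "(\<lambda>x. K +>\<^bsub>M\<^esub> x) \<in> right_module_hom R M (quotient_module M K)"
    using add smult car unfolding right_module_hom_def by auto
  show "K +>\<^bsub>M\<^esub> x = K \<longleftrightarrow> x \<in> K" if "x \<in> carrier M" for x
    using K.a_rcos_self[OF that] K.a_rcos_const[of x] by auto
qed

lemma submodule_sum_least:
  assumes M: "right_module R M" and D: "submodule D R M" and S: "\<And>N. N \<in> S \<Longrightarrow> N \<subseteq> D"
  shows "submodule_sum M S \<subseteq> D"
proof
  interpret M: right_module R M by fact
  note D' = D[unfolded submodule_iff[OF M]]
  fix x assume "x \<in> submodule_sum M S"
  then obtain g A where A: "finite A" "A \<subseteq> S" "\<forall>N\<in>A. g N \<in> N" "x = finsum M g A"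
    unfolding submodule_sum_def by auto
  have "\<forall>N\<in>A. g N \<in> D" using A S by blast
  with A(1) have "finsum M g A \<in> D"
  proof (induction A rule: finite_induct)
    case empty thus ?case using D' by simp
  next
    case (insert N B)
    have "finsum M g (insert N B) = g N \<oplus>\<^bsub>M\<^esub> finsum M g B"
      by (rule M.finsum_insert) (use insert D' in auto)
    thus ?case using insert D' by simp
  qed
  thus "x \<in> D" using A by simp
qed

lemma non_cosingular_image_sum:
  fixes R :: "('r, 'x) ring_scheme" and M :: "('r, 'm, 'y) module_scheme"
  assumes M: "right_module R M" and nc: "non_cosingular R M"
    and F: "F \<subseteq> right_module_hom R M M" and above: "lies_above R M (image_sum M F) D"
  shows "image_sum M F = D"
proof
  show "D \<subseteq> image_sum M F" using above unfolding lies_above_def by blast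
  have D: "submodule D R M" using above unfolding lies_above_def direct_summand_def by blast
  note Q = quotient_map[OF M D]
  define L where "L = {D +>\<^bsub>M\<^esub> x |x. x \<in> image_sum M F}"
  have sup: "superfluous R L (quotient_module M D)"
    using above unfolding lies_above_def L_def by blast
  have L: "submodule L R (quotient_module M D)" using sup unfolding superfluous_def by blast
  define V where "V = sub_module (quotient_module M D) L"
  have V: "right_module R V" unfolding V_def by (rule right_module_sub_module[OF Q(1) L])
  have "module_isomorphic R V (sub_module (quotient_module M D) L)"
    unfolding module_isomorphic_def V_def right_module_hom_def by (rule bexI[of _ id]) auto
  hence small: "small_module TYPE('m set) R V"
    unfolding small_module_def using V Q(1) sup by blast
  have "f x \<in> D" if f: "f \<in> F" and x: "x \<in> carrier M" for f x
  proof -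
    have fM: "f \<in> right_module_hom R M M" using f F by blast
    \<comment> \<open>The values of \<open>f\<close> lie in the sum, so following \<open>f\<close>
      by the coset map lands in the small module \<open>V\<close> and not merely in the whole
      quotient.\<close>
    have im: "f y \<in> image_sum M F" if "y \<in> carrier M" for y
      unfolding image_sum_def
      by (rule submodule_sum_mem[OF M _ right_module_hom_image[OF M M fM]]) (use f that in auto)
    have "(\<lambda>y. D +>\<^bsub>M\<^esub> f y) \<in> right_module_hom R M (quotient_module M D)"
      by (rule right_module_hom_comp[OF fM Q(2)])
    hence "(\<lambda>y. D +>\<^bsub>M\<^esub> f y) \<in> right_module_hom R M V"
      using im unfolding right_module_hom_def V_def L_def by auto
    \<comment> \<open>\<open>Z_bar_universe\<close> passes from the universe of
      \<open>non_cosingular\<close> to \<open>'m set\<close>, where \<open>V\<close> lives, so that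
      every map from \<open>M\<close> to \<open>V\<close> kills \<open>x\<close>.\<close>
    moreover have "x \<in> Z_bar TYPE('m set) R M"
      using Z_bar_universe[OF M, where 'w = "'m set"] nc x unfolding non_cosingular_def by blast
    ultimately have "D +>\<^bsub>M\<^esub> f x = \<zero>\<^bsub>V\<^esub>" using small unfolding Z_bar_def by blast
    hence "D +>\<^bsub>M\<^esub> f x = D" unfolding V_def quotient_module_def by simp
    thus ?thesis using Q(3)[of "f x"] fM x unfolding right_module_hom_def by blast
  qed
  thus "image_sum M F \<subseteq> D"
    unfolding image_sum_def by (intro submodule_sum_least[OF M D]) auto
qed

theorem corollary4p5:
  fixes R :: "('r, 'x) ring_scheme" and M :: "('r, 'm, 'y) module_scheme"
  assumes "right_module R M"
  shows "(non_singular R M \<and> self_CS_Baer R M \<longrightarrow> self_Baer R M) \<and>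
    (non_singular R M \<and> strongly_self_CS_Baer R M \<longrightarrow> strongly_self_Baer R M) \<and>
    (non_cosingular R M \<and> dual_self_CS_Baer R M \<longrightarrow> dual_self_Baer R M) \<and>
    (non_cosingular R M \<and> dual_strongly_self_CS_Baer R M \<longrightarrow> dual_strongly_self_Baer R M)"
proof (intro conjI impI; elim conjE)
  \<comment> \<open>The summand supplied by the hypothesis is itself the common kernel, so full
    invariance, when given, passes to the kernel along with the summand property.\<close>
  have ker: "common_kernel M F = D"
    if "non_singular R M" "F \<subseteq> right_module_hom R M M" "direct_summand R D M"
      "essential R (common_kernel M F) (sub_module M D)" for F D
    using non_singular_common_kernel[OF assms that(1,2) _ that(4)] that(3)
    unfolding direct_summand_def by blast
  show "self_Baer R M" if "non_singular R M" "self_CS_Baer R M"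
    using that(2) ker[OF that(1)] unfolding self_CS_Baer_def self_Baer_def by metis
  show "strongly_self_Baer R M" if "non_singular R M" "strongly_self_CS_Baer R M"
    using that(2) ker[OF that(1)] unfolding strongly_self_CS_Baer_def strongly_self_Baer_def
    by metis
  \<comment> \<open>The summand property of \<open>D\<close> is extracted from
    \<open>lies_above\<close>, since the dual hypotheses do not list it separately as the two above
    do.\<close>
  have im: "image_sum M F = D \<and> direct_summand R D M"
    if "non_cosingular R M" "F \<subseteq> right_module_hom R M M" "lies_above R M (image_sum M F) D" for F D
    using non_cosingular_image_sum[OF assms that] that(3) unfolding lies_above_def by blast
  show "dual_self_Baer R M" if "non_cosingular R M" "dual_self_CS_Baer R M"
    using that(2) im[OF that(1)] unfolding dual_self_CS_Baer_def dual_self_Baer_def by metis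
  show "dual_strongly_self_Baer R M" if "non_cosingular R M" "dual_strongly_self_CS_Baer R M"
    using that(2) im[OF that(1)]
    unfolding dual_strongly_self_CS_Baer_def dual_strongly_self_Baer_def by metis
qed

end
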